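(* Let $n,r\ge3$, let $h$ be a hermitian form on $\mathbb{C}^n$ of signature $(n-1,1)$ and $\mathrm{SU}(n-1,1)$ its special unitary group. Let $X^{ss}(\mathbb{R})$ be the set of semi-stable $r$-tuples of $h$-isotropic lines, $X^{ss}(\mathbb{R})/\mathrm{SU}(n-1,1)$ the separated quotient, and $W=\{(L_1,\dots,L_r)\in X^{ss}(\mathbb{R}):\dim(L_1+\dots+L_r)\ge3\}$. Then: (1) the map from the set of closed $\mathrm{SU}(n-1,1)$-orbits in $X^{ss}(\mathbb{R})$ contained in $W$ to $\mathbb{P}^{!r-1}(\mathbb{C})$ sending the orbit of $x$ to $[(s_\sigma(x))_{\sigma\in\mathfrak{D}_r}]$ is injective; (2) if $r$ is odd and $D\subset\mathfrak{D}_r$ is a subset with $!r/2$ elements such that $\sigma\in D\Rightarrow\sigma^{-1}\notin D$, then the map $\epsilon\colon X^{ss}(\mathbb{R})/\mathrm{SU}(n-1,1)\to(\mathbb{C}^{!r/2}\smallsetminus\{0\})/\mathbb{R}_{>0}$ sending the closed orbit of $x$ to the open ray generated by $(s_\sigma(x))_{\sigma\in D}$ is injective; (3) if $r$ is even and $x,x'\in X^{ss}(\mathbb{R})$, then the vectors $(s_\sigma(x))_{\sigma\in\mathfrak{D}_r}$ and $(s_\sigma(x'))_{\sigma\in\mathfrak{D}_r}$ differ by a positive real factor if and only if they define the same point of $\mathbb{P}^{!r-1}(\mathbb{C})$.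
   Context: $h(v,w)$ is linear in $w$ and conjugate-linear in $v$. An $r$-tuple $x=(L_1,\dots,L_r)$ of isotropic lines is semi-stable if the $r$-tuple of flags $(L_i,L_i^\perp)$ is semi-stable for the diagonal $\mathrm{SL}_n(\mathbb{C})$-action on the $r$-th power of the variety of line-hyperplane flags, linearized via $(L_i,H_i)\mapsto(L_i,H_i^\perp)\in(\mathbb{P}(\mathbb{C}^n)\times\mathbb{P}((\mathbb{C}^n)^\vee))^r$ and $\bigotimes_i\mathrm{pr}_i^*(\mathcal{O}(1)\boxtimes\mathcal{O}(1))$ (some invariant section of a positive tensor power does not vanish). $\mathfrak{D}_r$ is the set of derangements (fixed-point-free permutations) of $\{1,\dots,r\}$, $!r=\#\mathfrak{D}_r$. For $\sigma\in\mathfrak{D}_r$, $s_\sigma(x)=\prod_{i=1}^r h(v_i,v_{\sigma(i)})$ with $v_i$ a generator of $L_i$; replacing $v_i$ by $\lambda_iv_i$ multiplies all $s_\sigma(x)$ by $\prod|\lambda_i|^2>0$. The separated quotient $X^{ss}(\mathbb{R})/\mathrm{SU}(n-1,1)$ is the set of closed $\mathrm{SU}(n-1,1)$-orbits in $X^{ss}(\mathbb{R})$, each point $x$ being sent to the unique closed orbit in the closure of its orbit, with the quotient topology; maps on it are defined by evaluating on a point of the closed orbit. *)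

theory Defs
  imports "HOL-Analysis.Analysis"
begin

definition hform :: "complex^'n^'n \<Rightarrow> complex^'n \<Rightarrow> complex^'n \<Rightarrow> complex" where
  "hform H v w = (\<Sum>j\<in>UNIV. \<Sum>k\<in>UNIV. cnj (v $ j) * (H $ j $ k) * (w $ k))"

definition hermitian_mat :: "complex^'n^'n \<Rightarrow> bool" where
  "hermitian_mat H \<longleftrightarrow> (\<forall>j k. H $ j $ k = cnj (H $ k $ j))"

definition signature_n1_1 :: "complex^'n^'n \<Rightarrow> bool" where
  "signature_n1_1 H \<longleftrightarrow> (\<exists>A::complex^'n^'n. invertible A \<and> (\<exists>j0. \<forall>j k.
      hform H (column j A) (column k A) = (if j \<noteq> k then 0 else if j = j0 then -1 else 1)))"

definition SU_h :: "complex^'n^'n \<Rightarrow> (complex^'n^'n) set" where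
  "SU_h H = {g. det g = 1 \<and> (\<forall>v w. hform H (g *v v) (g *v w) = hform H v w)}"

text \<open>Coordinates of the linear functional h(v, -), i.e. a generator of the
  annihilator of the hyperplane v^perp.\<close>
definition hdual :: "complex^'n^'n \<Rightarrow> complex^'n \<Rightarrow> complex^'n" where
  "hdual H v = (\<chi> k. \<Sum>j\<in>UNIV. cnj (v $ j) * H $ j $ k)"

inductive_set polyfun :: "nat \<Rightarrow> ((nat \<Rightarrow> complex^'n) \<Rightarrow> (nat \<Rightarrow> complex^'n) \<Rightarrow> complex) set"
  for r :: nat where
  pf_const: "(\<lambda>v phi. c) \<in> polyfun r"
| pf_coord_v: "i < r \<Longrightarrow> (\<lambda>v phi. v i $ j) \<in> polyfun r"
| pf_coord_phi: "i < r \<Longrightarrow> (\<lambda>v phi. phi i $ j) \<in> polyfun r"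
| pf_add: "f \<in> polyfun r \<Longrightarrow> g \<in> polyfun r \<Longrightarrow> (\<lambda>v phi. f v phi + g v phi) \<in> polyfun r"
| pf_mult: "f \<in> polyfun r \<Longrightarrow> g \<in> polyfun r \<Longrightarrow> (\<lambda>v phi. f v phi * g v phi) \<in> polyfun r"

text \<open>Multihomogeneous of degree (k,k) in each factor P(C^n) x P((C^n)^dual), i.e. a
  section of the k-th tensor power of the linearization.\<close>
definition multihom :: "nat \<Rightarrow> nat \<Rightarrow> ((nat \<Rightarrow> complex^'n) \<Rightarrow> (nat \<Rightarrow> complex^'n) \<Rightarrow> complex) \<Rightarrow> bool" where
  "multihom r k f \<longleftrightarrow> (\<forall>i<r. \<forall>c v phi.
      f (v(i := c *s v i)) phi = c ^ k * f v phi \<and> f v (phi(i := c *s phi i)) = c ^ k * f v phi)"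

definition SL_invariant :: "((nat \<Rightarrow> complex^'n) \<Rightarrow> (nat \<Rightarrow> complex^'n) \<Rightarrow> complex) \<Rightarrow> bool" where
  "SL_invariant f \<longleftrightarrow> (\<forall>g::complex^'n^'n. det g = 1 \<longrightarrow>
      (\<forall>v phi. f (\<lambda>i. g *v v i) (\<lambda>i. phi i v* matrix_inv g) = f v phi))"

text \<open>An r-tuple of isotropic lines, given by generators v_0..v_{r-1}.\<close>
definition iso_tuple :: "complex^'n^'n \<Rightarrow> nat \<Rightarrow> (nat \<Rightarrow> complex^'n) \<Rightarrow> bool" where
  "iso_tuple H r v \<longleftrightarrow> (\<forall>i<r. v i \<noteq> 0 \<and> hform H (v i) (v i) = 0)"

definition semistable :: "complex^'n^'n \<Rightarrow> nat \<Rightarrow> (nat \<Rightarrow> complex^'n) \<Rightarrow> bool" where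
  "semistable H r v \<longleftrightarrow> (\<exists>k>0. \<exists>f\<in>polyfun r. multihom r k f \<and> SL_invariant f \<and>
      f v (\<lambda>i. hdual H (v i)) \<noteq> 0)"

definition Xss :: "complex^'n^'n \<Rightarrow> nat \<Rightarrow> (nat \<Rightarrow> complex^'n) \<Rightarrow> bool" where
  "Xss H r v \<longleftrightarrow> iso_tuple H r v \<and> semistable H r v"

definition same_lines :: "nat \<Rightarrow> (nat \<Rightarrow> complex^'n) \<Rightarrow> (nat \<Rightarrow> complex^'n) \<Rightarrow> bool" where
  "same_lines r v w \<longleftrightarrow> (\<forall>i<r. \<exists>c::complex. c \<noteq> 0 \<and> v i = c *s w i)"

definition same_orbit :: "complex^'n^'n \<Rightarrow> nat \<Rightarrow> (nat \<Rightarrow> complex^'n) \<Rightarrow> (nat \<Rightarrow> complex^'n) \<Rightarrow> bool" where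
  "same_orbit H r v w \<longleftrightarrow> (\<exists>g\<in>SU_h H. same_lines r (\<lambda>i. g *v v i) w)"

text \<open>Convergence in (P^{n-1}(C))^r of a sequence of tuples of lines u_k to the tuple w
  (w i nonzero): after rescaling representatives, they converge in C^n.\<close>
definition proj_conv :: "nat \<Rightarrow> (nat \<Rightarrow> nat \<Rightarrow> complex^'n) \<Rightarrow> (nat \<Rightarrow> complex^'n) \<Rightarrow> bool" where
  "proj_conv r u w \<longleftrightarrow> (\<forall>i<r. \<exists>c::nat \<Rightarrow> complex. (\<lambda>k. c k *s u k i) \<longlonglongrightarrow> w i)"

definition in_orbit_closure :: "complex^'n^'n \<Rightarrow> nat \<Rightarrow> (nat \<Rightarrow> complex^'n) \<Rightarrow> (nat \<Rightarrow> complex^'n) \<Rightarrow> bool" where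
  "in_orbit_closure H r v w \<longleftrightarrow> (\<exists>g::nat \<Rightarrow> complex^'n^'n. (\<forall>k. g k \<in> SU_h H) \<and>
      proj_conv r (\<lambda>k i. g k *v v i) w)"

definition closed_orbit :: "complex^'n^'n \<Rightarrow> nat \<Rightarrow> (nat \<Rightarrow> complex^'n) \<Rightarrow> bool" where
  "closed_orbit H r v \<longleftrightarrow> (\<forall>w. Xss H r w \<longrightarrow> in_orbit_closure H r v w \<longrightarrow> same_orbit H r v w)"

definition derangements :: "nat \<Rightarrow> (nat \<Rightarrow> nat) set" where
  "derangements r = {\<sigma>. \<sigma> permutes {..<r} \<and> (\<forall>i<r. \<sigma> i \<noteq> i)}"

definition s_der :: "complex^'n^'n \<Rightarrow> nat \<Rightarrow> (nat \<Rightarrow> complex^'n) \<Rightarrow> (nat \<Rightarrow> nat) \<Rightarrow> complex" where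
  "s_der H r v \<sigma> = (\<Prod>i<r. hform H (v i) (v (\<sigma> i)))"

end

theory Submission
  imports Defs
begin

text \<open>
  Distinct isotropic lines are never orthogonal, and the boosts of a hyperbolic plane show that a
  tuple is semi-stable only if no line occurs more than \<open>r/2\<close> times; a derangement then avoids
  all pairs of equal lines. If every line occurs less than \<open>r/2\<close> times, comparing derangements
  that differ on two rows shows that the entrywise quotient of two Gram matrices with
  proportional \<open>s\<^sub>\<sigma>\<close> has vanishing 2-by-2 minors after normalising by the rows of a most frequent
  line, so the Gram matrices agree up to rescaling the generators and a real factor \<open>t\<close>. If
  \<open>t > 0\<close>, Witt's theorem yields an isometry, and a unit scalar makes its determinant 1. The sign
  of \<open>t\<close> is fixed by the signature if the span has dimension at least 3, and by the positive
  factor if \<open>r\<close> is odd. A closed orbit has a line of multiplicity \<open>r/2\<close> only if it spans a plane.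
  For even \<open>r\<close>, a fixed-point-free involution gives a positive \<open>s\<^sub>\<sigma>\<close>, which forces a complex
  factor to be positive.
\<close>

text \<open>The Gram matrix vanishes on every pair of equal lines, so its entrywise quotient is
  defined only off the diagonal blocks, and a relation between entries is available only if the
  permutations expressing it can be completed without meeting a block. The condition for such a
  completion is Hall's and concerns one colour at a time; multiplicities below \<open>r/2\<close>
  leave the slack needed to prescribe a few rows. Rescaling the generators by \<open>lam\<close> and
  the form by \<open>t\<close> multiplies each product by \<open>t ^ r\<close> and by squared
  moduli. For even \<open>r\<close> the products therefore do not see the sign of \<open>t\<close>,
  and on a plane of signature (1,1) the forms \<open>h\<close> and \<open>-h\<close> are equivalent,
  so a negative \<open>t\<close> cannot be excluded there. This is why claim (1) is confined to
  spans of dimension at least 3 and claim (2) to odd \<open>r\<close>.\<close>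

section \<open>Recovering a matrix from its derangement products\<close>

text \<open>The hypothesis is Hall's condition for avoiding one's own colour. Take a bijection with
  the fewest bad points. If \<open>a\<close> is bad, the points of its colour and the points sent to
  that colour overlap in \<open>a\<close>, so they miss some \<open>b\<close>; exchanging the values
  at \<open>a\<close> and \<open>b\<close> repairs \<open>a\<close> and spoils nothing.\<close>

lemma colour_avoiding_bij:
  fixes cls :: "'a \<Rightarrow> 'c"
  assumes "finite R" "finite S" "card R = card S"
    and hall: "\<And>x. card {a\<in>R. cls a = x} + card {b\<in>S. cls b = x} \<le> card R"
  obtains f where "bij_betw f R S" "\<And>a. a \<in> R \<Longrightarrow> cls (f a) \<noteq> cls a"
proof -
  define bad where "bad f = {a\<in>R. cls (f a) = cls a}" for f
  obtain f0 where "bij_betw f0 R S"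
    using finite_same_card_bij[OF assms(1-3)] by blast
  then obtain f where f: "bij_betw f R S" and
    least: "\<And>g. bij_betw g R S \<Longrightarrow> card (bad f) \<le> card (bad g)"
    using ex_has_least_nat[of "\<lambda>f. bij_betw f R S" f0 "\<lambda>f. card (bad f)"] by auto
  have "cls (f a) \<noteq> cls a" if "a \<in> R" for a
  proof
    assume a: "cls (f a) = cls a"
    let ?x = "cls a"
    let ?X = "{z\<in>R. cls z = ?x}" and ?Y = "{z\<in>R. cls (f z) = ?x}"
    have img: "f ` ?Y = {b\<in>S. cls b = ?x}"
      using f by (auto simp: bij_betw_def)
    have "inj_on f ?Y"
      using f by (auto simp: bij_betw_def inj_on_def)
    then have "card ?Y = card {b\<in>S. cls b = ?x}"
      unfolding img[symmetric] by (rule card_image[symmetric])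
    then have sum: "card ?X + card ?Y \<le> card R"
      using hall[of ?x] by simp
    have "?X \<inter> ?Y \<noteq> {}"
      using a that by auto
    then have "card (?X \<inter> ?Y) > 0"
      using assms(1) by (simp add: card_gt_0_iff)
    then have "card (?X \<union> ?Y) < card R"
      using sum card_Un_Int[of ?X ?Y] assms(1) by simp
    then have "?X \<union> ?Y \<noteq> R" by auto
    then obtain b where b: "b \<in> R" "cls b \<noteq> ?x" "cls (f b) \<noteq> ?x" by auto
    define g where "g = f \<circ> Transposition.transpose a b"
    have "Transposition.transpose a b permutes R"
      using that b by (simp add: permutes_swap_id)
    then have "bij_betw g R S"
      unfolding g_def by (rule bij_betw_trans[OF permutes_imp_bij f])
    then have "card (bad f) \<le> card (bad g)" by (rule least)
    moreover have "bad g \<subset> bad f"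
    proof
      show "bad g \<subseteq> bad f"
      proof
        fix z assume "z \<in> bad g"
        then show "z \<in> bad f"
          using a b by (cases "z = a"; cases "z = b") (auto simp: bad_def g_def)
      qed
      have "a \<in> bad f" "a \<notin> bad g"
        using a b that by (auto simp: bad_def g_def)
      then show "bad g \<noteq> bad f" by blast
    qed
    moreover have "finite (bad f)"
      using assms(1) by (simp add: bad_def)
    ultimately show False
      by (meson not_le psubset_card_mono)
  qed
  with f show thesis by (rule that)
qed

text \<open>\<open>hall\<close> is the condition of \<open>colour_avoiding_bij\<close> for the
  remaining rows \<open>U - A\<close> and columns \<open>U - B\<close>, with subtractions moved to
  the other side. Prescribed positions of colour \<open>x\<close> relax it for
  \<open>x\<close>.\<close>

lemma colour_avoiding_bij_extend:
  fixes cls :: "'a \<Rightarrow> 'c"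
  assumes "finite U" "A \<subseteq> U" "B \<subseteq> U" and p: "bij_betw p A B"
    and avoid: "\<And>a. a \<in> A \<Longrightarrow> cls (p a) \<noteq> cls a"
    and hall: "\<And>x. 2 * card {a\<in>U. cls a = x} + card A
      \<le> card U + card {a\<in>A. cls a = x} + card {b\<in>B. cls b = x}"
  obtains f where "bij_betw f U U" "\<And>a. a \<in> A \<Longrightarrow> f a = p a"
    "\<And>a. a \<in> U \<Longrightarrow> cls (f a) \<noteq> cls a"
proof -
  have fin: "finite A" "finite B"
    using assms(1-3) by (auto intro: finite_subset)
  have AB: "card A = card B"
    using p by (rule bij_betw_same_card)
  have split: "card {a\<in>U - C. cls a = x} + card {a\<in>C. cls a = x} = card {a\<in>U. cls a = x}"
    if "C \<subseteq> U" for C x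
  proof -
    have "card ({a\<in>U - C. cls a = x} \<union> {a\<in>C. cls a = x}) =
        card {a\<in>U - C. cls a = x} + card {a\<in>C. cls a = x}"
      using assms(1) that by (intro card_Un_disjoint) (auto intro: finite_subset)
    moreover have "{a\<in>U - C. cls a = x} \<union> {a\<in>C. cls a = x} = {a\<in>U. cls a = x}"
      using that by auto
    ultimately show ?thesis by simp
  qed
  have cUA: "card (U - A) = card U - card A" "card (U - B) = card U - card A" "card A \<le> card U"
    using assms(1-3) fin AB by (simp_all add: card_Diff_subset card_mono)
  obtain q where q: "bij_betw q (U - A) (U - B)" "\<And>a. a \<in> U - A \<Longrightarrow> cls (q a) \<noteq> cls a"
  proof (rule colour_avoiding_bij[of "U - A" "U - B" cls])
    show "finite (U - A)" "finite (U - B)" "card (U - A) = card (U - B)"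
      using assms(1) cUA by simp_all
    show "card {a\<in>U - A. cls a = x} + card {b\<in>U - B. cls b = x} \<le> card (U - A)" for x
      using hall[of x] split[OF assms(2), of x] split[OF assms(3), of x] cUA by linarith
  qed blast
  define f where "f a = (if a \<in> A then p a else q a)" for a
  have "bij_betw f A B"
    using p by (subst bij_betw_cong[of _ _ p]) (auto simp: f_def)
  moreover have "bij_betw f (U - A) (U - B)"
    using q(1) by (subst bij_betw_cong[of _ _ q]) (auto simp: f_def)
  ultimately have "bij_betw f (A \<union> (U - A)) (B \<union> (U - B))"
    by (rule bij_betw_combine) auto
  moreover have "A \<union> (U - A) = U" "B \<union> (U - B) = U"
    using assms(2,3) by auto
  ultimately have "bij_betw f U U" by simp
  then show thesis
    using that[of f] avoid q(2) by (auto simp: f_def)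
qed

text \<open>\<open>cls\<close> abstracts the map from indices to lines: distinct lines of a tuple are not orthogonal.\<close>

locale gram_pair =
  fixes U :: "'a set" and cls :: "'a \<Rightarrow> 'c" and G G' :: "'a \<Rightarrow> 'a \<Rightarrow> complex" and l :: complex
  assumes fin: "finite U" and ne: "U \<noteq> {}"
    and herm: "\<And>i j. i \<in> U \<Longrightarrow> j \<in> U \<Longrightarrow> G j i = cnj (G i j)"
    and herm': "\<And>i j. i \<in> U \<Longrightarrow> j \<in> U \<Longrightarrow> G' j i = cnj (G' i j)"
    and zero: "\<And>i j. i \<in> U \<Longrightarrow> j \<in> U \<Longrightarrow> G i j = 0 \<longleftrightarrow> cls i = cls j"
    and zero': "\<And>i j. i \<in> U \<Longrightarrow> j \<in> U \<Longrightarrow> G' i j = 0 \<longleftrightarrow> cls i = cls j"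
    and small: "\<And>x. 2 * card {a\<in>U. cls a = x} < card U"
    and l: "l \<noteq> 0"
    and prods: "\<And>f. bij_betw f U U \<Longrightarrow> (\<Prod>a\<in>U. G a (f a)) = l * (\<Prod>a\<in>U. G' a (f a))"
begin

definition \<rho> where "\<rho> i j = G i j / G' i j"

lemma \<rho>_nonzero: "i \<in> U \<Longrightarrow> j \<in> U \<Longrightarrow> cls i \<noteq> cls j \<Longrightarrow> \<rho> i j \<noteq> 0"
  using zero[of i j] zero'[of i j] by (simp add: \<rho>_def)

lemma \<rho>_cnj: "i \<in> U \<Longrightarrow> j \<in> U \<Longrightarrow> \<rho> j i = cnj (\<rho> i j)"
  using herm[of i j] herm'[of i j] by (simp add: \<rho>_def)

lemma \<rho>_prod:
  assumes "bij_betw f U U" "\<And>a. a \<in> U \<Longrightarrow> cls (f a) \<noteq> cls a"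
  shows "(\<Prod>a\<in>U. \<rho> a (f a)) = l"
proof -
  have "f a \<in> U" if "a \<in> U" for a
    using assms(1) that by (auto simp: bij_betw_def)
  then have "(\<Prod>a\<in>U. G' a (f a)) \<noteq> 0"
    using fin zero' assms(2) by (force simp: prod_zero_iff)
  then show ?thesis
    using prods[OF assms(1)] by (simp add: \<rho>_def prod_dividef)
qed

text \<open>The source of the relations between entries of \<open>\<rho>\<close>: one completion on
  the rows outside \<open>A\<close> serves both \<open>p\<close> and \<open>p'\<close>, and its
  factors cancel because the full product is \<open>l \<noteq> 0\<close>.\<close>

lemma \<rho>_prod_eq:
  assumes "A \<subseteq> U" "bij_betw p A B" "B \<subseteq> U" "bij_betw p' A B"
    and "\<And>a. a \<in> A \<Longrightarrow> cls (p a) \<noteq> cls a" "\<And>a. a \<in> A \<Longrightarrow> cls (p' a) \<noteq> cls a"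
    and "\<And>x. 2 * card {a\<in>U. cls a = x} + card A
      \<le> card U + card {a\<in>A. cls a = x} + card {b\<in>B. cls b = x}"
  shows "(\<Prod>a\<in>A. \<rho> a (p a)) = (\<Prod>a\<in>A. \<rho> a (p' a))"
proof -
  obtain f where f: "bij_betw f U U" "\<And>a. a \<in> A \<Longrightarrow> f a = p a"
    "\<And>a. a \<in> U \<Longrightarrow> cls (f a) \<noteq> cls a"
    using colour_avoiding_bij_extend[OF fin assms(1,3,2,5,7)] by blast
  define g where "g a = (if a \<in> A then p' a else f a)" for a
  have "f ` A = B"
    using assms(2) f(2) by (auto simp: bij_betw_def)
  then have fAB: "bij_betw f (U - A) (U - B)"
    using f(1) assms(1) by (metis bij_betw_def bij_betw_imp_inj_on inj_on_diff inj_on_image_set_diff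
        Diff_subset)
  have "bij_betw g A B"
    using assms(4) by (subst bij_betw_cong[of _ _ p']) (auto simp: g_def)
  moreover have "bij_betw g (U - A) (U - B)"
    using fAB by (subst bij_betw_cong[of _ _ f]) (auto simp: g_def)
  ultimately have "bij_betw g (A \<union> (U - A)) (B \<union> (U - B))"
    by (rule bij_betw_combine) auto
  moreover have "A \<union> (U - A) = U" "B \<union> (U - B) = U"
    using assms(1,3) by auto
  ultimately have g: "bij_betw g U U" by simp
  have gcls: "cls (g a) \<noteq> cls a" if "a \<in> U" for a
    using that f(3) assms(6) by (simp add: g_def)
  have split: "(\<Prod>a\<in>U. h a) = (\<Prod>a\<in>U - A. h a) * (\<Prod>a\<in>A. h a)" for h :: "'a \<Rightarrow> complex"
    by (rule prod.subset_diff[OF assms(1) fin])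
  have rest: "(\<Prod>a\<in>U - A. \<rho> a (g a)) = (\<Prod>a\<in>U - A. \<rho> a (f a))"
    by (rule prod.cong) (auto simp: g_def)
  have pA: "(\<Prod>a\<in>A. \<rho> a (g a)) = (\<Prod>a\<in>A. \<rho> a (p' a))"
    "(\<Prod>a\<in>A. \<rho> a (f a)) = (\<Prod>a\<in>A. \<rho> a (p a))"
    using f(2) by (auto simp: g_def intro!: prod.cong)
  have "(\<Prod>a\<in>U - A. \<rho> a (f a)) * (\<Prod>a\<in>A. \<rho> a (p a)) = l"
    using \<rho>_prod[OF f(1,3)] by (simp add: split pA)
  moreover have "(\<Prod>a\<in>U - A. \<rho> a (f a)) * (\<Prod>a\<in>A. \<rho> a (p' a)) = l"
    using \<rho>_prod[OF g gcls] by (simp add: split pA rest)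
  ultimately show ?thesis
    using l by (metis mult_cancel_left mult_eq_0_iff)
qed

text \<open>Comparing two permutations that differ only on the rows \<open>i\<close> and \<open>c\<close> gives a vanishing
  2-by-2 minor of \<open>\<rho>\<close>; such permutations exist because \<open>c\<close> lies in a largest class.\<close>

lemma \<rho>_minor:
  assumes c: "c \<in> U" and largest: "\<And>x. card {a\<in>U. cls a = x} \<le> card {a\<in>U. cls a = cls c}"
    and "i \<in> U" "j \<in> U" "k \<in> U" "cls j \<noteq> cls c" "cls k \<noteq> cls c" "cls i \<noteq> cls j" "cls i \<noteq> cls k"
  shows "\<rho> i j * \<rho> c k = \<rho> i k * \<rho> c j"
proof (cases "i = c \<or> j = k")
  case False
  then have "i \<noteq> c" "j \<noteq> k" by auto
  have "(\<Prod>a\<in>{i,c}. \<rho> a (if a = i then j else k)) = (\<Prod>a\<in>{i,c}. \<rho> a (if a = i then k else j))"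
  proof (rule \<rho>_prod_eq)
    show "bij_betw (\<lambda>a. if a = i then j else k) {i, c} {j, k}"
      "bij_betw (\<lambda>a. if a = i then k else j) {i, c} {j, k}"
      using \<open>i \<noteq> c\<close> \<open>j \<noteq> k\<close> by (auto simp: bij_betw_def inj_on_def)
    have ic: "card {i, c} = 2" using \<open>i \<noteq> c\<close> by simp
    show "2 * card {a\<in>U. cls a = x} + card {i, c}
      \<le> card U + card {a\<in>{i, c}. cls a = x} + card {b\<in>{j, k}. cls b = x}" for x
    proof (cases "\<exists>a\<in>{i,c,j,k}. cls a = x")
      \<comment> \<open>A colour met by a prescribed row or column gains at least 1 on the right;
        together with the strict inequality \<open>small\<close> this pays for the 2 on the
        left.\<close>
      case True
      then have "{a\<in>{i, c}. cls a = x} \<noteq> {} \<or> {b\<in>{j, k}. cls b = x} \<noteq> {}" by blast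
      then have "card {a\<in>{i, c}. cls a = x} > 0 \<or> card {b\<in>{j, k}. cls b = x} > 0"
        by (simp add: card_gt_0_iff)
      then show ?thesis
        using small[of x] ic by linarith
    next
      \<comment> \<open>The classes of \<open>x\<close> and \<open>c\<close> are disjoint and avoid
        \<open>j\<close> and \<open>k\<close>, so together they have at most
        \<open>card U - 2\<close> elements; \<open>x\<close> has at most half of that because
        \<open>c\<close> lies in a largest class.\<close>
      case False
      have "card ({a\<in>U. cls a = x} \<union> {a\<in>U. cls a = cls c}) =
          card {a\<in>U. cls a = x} + card {a\<in>U. cls a = cls c}"
        using fin False by (intro card_Un_disjoint) auto
      moreover have "{a\<in>U. cls a = x} \<union> {a\<in>U. cls a = cls c} \<subseteq> U - {j, k}"
        using False assms(3-9) by auto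
      then have "card ({a\<in>U. cls a = x} \<union> {a\<in>U. cls a = cls c}) \<le> card (U - {j, k})"
        using fin by (intro card_mono) auto
      moreover have "card (U - {j, k}) = card U - 2" "card {j, k} \<le> card U"
        using assms(3-5) \<open>j \<noteq> k\<close> fin card_mono[of U "{j,k}"] by (auto simp: card_Diff_subset)
      ultimately show ?thesis
        using largest[of x] ic \<open>j \<noteq> k\<close> by simp
    qed
  qed (use c assms(3-9) in \<open>auto split: if_splits\<close>)
  then show ?thesis
    using \<open>i \<noteq> c\<close> by simp
qed auto

text \<open>Compares a 3-cycle with its inverse; with only three classes, every occurring colour is
  met by the prescribed rows and columns, which secures Hall's condition. As \<open>\<rho>\<close>
  is hermitian, the equation says that the triple product is real.\<close>

lemma \<rho>_triangle:
  assumes "i \<in> U" "j \<in> U" "k \<in> U" "cls i \<noteq> cls j" "cls j \<noteq> cls k" "cls k \<noteq> cls i"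
    and only: "\<And>a. a \<in> U \<Longrightarrow> cls a = cls i \<or> cls a = cls j \<or> cls a = cls k"
  shows "\<rho> i j * \<rho> j k * \<rho> k i = \<rho> j i * \<rho> k j * \<rho> i k"
proof -
  have ne: "i \<noteq> j" "j \<noteq> k" "k \<noteq> i" using assms by auto
  have "(\<Prod>a\<in>{i,j,k}. \<rho> a (if a = i then j else if a = j then k else i)) =
    (\<Prod>a\<in>{i,j,k}. \<rho> a (if a = i then k else if a = j then i else j))"
  proof (rule \<rho>_prod_eq)
    show "bij_betw (\<lambda>a. if a = i then j else if a = j then k else i) {i,j,k} {i,j,k}"
      "bij_betw (\<lambda>a. if a = i then k else if a = j then i else j) {i,j,k} {i,j,k}"
      using ne by (auto simp: bij_betw_def inj_on_def)
    show "2 * card {a\<in>U. cls a = x} + card {i,j,k}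
      \<le> card U + card {a\<in>{i,j,k}. cls a = x} + card {b\<in>{i,j,k}. cls b = x}" for x
    proof (cases "{a\<in>{i,j,k}. cls a = x} = {}")
      case True
      then have x: "cls i \<noteq> x" "cls j \<noteq> x" "cls k \<noteq> x" by blast+
      have "cls a \<noteq> x" if "a \<in> U" for a
        using only[OF that] x by (elim disjE) simp_all
      then have "{a\<in>U. cls a = x} = {}" by blast
      then have "card {a\<in>U. cls a = x} = 0" by (simp only: card.empty)
      moreover have "card {i,j,k} \<le> card U"
        using assms(1-3) fin by (intro card_mono) auto
      ultimately show ?thesis by linarith
    next
      case False
      then have "card {a\<in>{i,j,k}. cls a = x} > 0"
        by (subst card_gt_0_iff) simp
      moreover have "card {i,j,k} = 3" using ne by simp
      ultimately show ?thesis
        using small[of x] by linarith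
    qed
  qed (use assms(1-6) in \<open>auto split: if_splits\<close>)
  then show ?thesis
    using ne by (simp add: mult_ac)
qed

lemma proportional_gram:
  obtains t :: real and lam where "t \<noteq> 0" "\<And>i. i \<in> U \<Longrightarrow> lam i \<noteq> 0"
    "\<And>i j. i \<in> U \<Longrightarrow> j \<in> U \<Longrightarrow> G i j = of_real t * lam i * cnj (lam j) * G' i j"
proof -
  define N where "N x = card {a\<in>U. cls a = x}" for x
  have "Max ((N \<circ> cls) ` U) \<in> (N \<circ> cls) ` U"
    using fin ne by (intro Max_in) auto
  then obtain c where Nc: "Max ((N \<circ> cls) ` U) = (N \<circ> cls) c" and c: "c \<in> U"
    by (rule imageE)
  have "N x \<le> N (cls c)" for x
  proof (cases "\<exists>b\<in>U. cls b = x")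
    case True
    then obtain b where "b \<in> U" "cls b = x" by blast
    then have "(N \<circ> cls) b \<le> Max ((N \<circ> cls) ` U)"
      using fin by (intro Max_ge) auto
    then show ?thesis
      using Nc \<open>cls b = x\<close> by simp
  next
    case False
    then have "{a\<in>U. cls a = x} = {}" by blast
    then show ?thesis by (simp only: N_def card.empty)
  qed
  then have largest: "card {a\<in>U. cls a = x} \<le> card {a\<in>U. cls a = cls c}" for x
    by (simp add: N_def)
  note minor = \<rho>_minor[OF c largest]
  define V where "V = {a\<in>U. cls a \<noteq> cls c}"
  have V: "a \<in> U" "cls a \<noteq> cls c" "\<rho> c a \<noteq> 0" "\<rho> a c \<noteq> 0" if "a \<in> V" for a
    using that c \<rho>_nonzero[of c a] \<rho>_nonzero[of a c] by (auto simp: V_def)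
  \<comment> \<open>Dividing by the row and column of \<open>c\<close> removes the unknown factors
    \<open>lam i\<close> and \<open>cnj (lam j)\<close>; what remains should be a real
    constant.\<close>
  define \<tau> where "\<tau> i j = \<rho> i j / (\<rho> i c * \<rho> c j)" for i j
  have \<tau>_cnj: "\<tau> j i = cnj (\<tau> i j)" if "i \<in> V" "j \<in> V" for i j
    using that c V(1) \<rho>_cnj[of i j] \<rho>_cnj[of c j] \<rho>_cnj[of i c] by (simp add: \<tau>_def)
  have \<tau>_row: "\<tau> i j = \<tau> i k" if "i \<in> V" "j \<in> V" "k \<in> V" "cls i \<noteq> cls j" "cls i \<noteq> cls k" for i j k
    using minor[of i j k] that V by (simp add: \<tau>_def field_simps)
  have \<tau>_sym: "\<tau> i j = \<tau> j i" if ij: "i \<in> V" "j \<in> V" "cls i \<noteq> cls j" for i j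
  proof (cases "\<exists>k\<in>V. cls k \<noteq> cls i \<and> cls k \<noteq> cls j")
    case True
    then obtain k where k: "k \<in> V" "cls k \<noteq> cls i" "cls k \<noteq> cls j" by blast
    have "\<tau> i j = \<tau> i k" using ij k by (intro \<tau>_row) auto
    also have "\<tau> i k = cnj (\<tau> k i)" using ij k by (intro \<tau>_cnj) auto
    also have "\<tau> k i = \<tau> k j" using ij k by (intro \<tau>_row) auto
    also have "cnj (\<tau> k j) = \<tau> j k" using ij k by (intro \<tau>_cnj[symmetric]) auto
    also have "\<tau> j k = \<tau> j i" using ij k by (intro \<tau>_row) auto
    finally show ?thesis .
  next
    \<comment> \<open>Only the classes of \<open>i\<close>, \<open>j\<close> and \<open>c\<close>
      are left, so the detour through a further index \<open>k\<close> is replaced by the triangle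
      relation.\<close>
    case False
    have "cls a = cls i \<or> cls a = cls j \<or> cls a = cls c" if "a \<in> U" for a
      using False that by (cases "a \<in> V") (auto simp: V_def)
    then have "\<rho> i j * \<rho> j c * \<rho> c i = \<rho> j i * \<rho> c j * \<rho> i c"
      using V(1,2)[OF ij(1)] V(1,2)[OF ij(2)] by (intro \<rho>_triangle c ij(3)) auto
    then show ?thesis
      using V[OF ij(1)] V[OF ij(2)] by (simp add: \<tau>_def field_simps)
  qed
  have \<tau>_const: "\<tau> i j = \<tau> k m"
    if "i \<in> V" "j \<in> V" "cls i \<noteq> cls j" "k \<in> V" "m \<in> V" "cls k \<noteq> cls m" for i j k m
  proof (cases "cls i = cls m")
    case False
    have "\<tau> i j = \<tau> m i" using that False \<tau>_row[of i j m] \<tau>_sym[of i m] by metis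
    then show ?thesis using that False \<tau>_row[of m i k] \<tau>_sym[of m k] by metis
  next
    case True
    have "\<tau> i j = \<tau> j m" using that True \<tau>_row[of j i m] \<tau>_sym[of i j] by metis
    also have "\<dots> = \<tau> m k" using that True \<tau>_row[of m j k] \<tau>_sym[of m j] by metis
    finally show ?thesis using that \<tau>_sym[of k m] by metis
  qed
  have "{a\<in>U. cls a = cls c} \<noteq> U"
    using small[of "cls c"] by force
  then obtain p where p: "p \<in> V" by (auto simp: V_def)
  \<comment> \<open>Two classes, each smaller than half of \<open>U\<close>, cannot cover it; a
    third class provides a pair \<open>p\<close>, \<open>q\<close> on which \<open>\<tau>\<close>
    can be evaluated.\<close>
  have "card ({a\<in>U. cls a = cls c} \<union> {a\<in>U. cls a = cls p}) < card U"
    using small[of "cls c"] small[of "cls p"]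
      card_Un_le[of "{a\<in>U. cls a = cls c}" "{a\<in>U. cls a = cls p}"] by linarith
  then have "{a\<in>U. cls a = cls c} \<union> {a\<in>U. cls a = cls p} \<noteq> U" by auto
  then obtain q where q: "q \<in> V" "cls q \<noteq> cls p" by (auto simp: V_def)
  have "\<tau> p q = cnj (\<tau> p q)"
    using \<tau>_cnj[OF q(1) p] \<tau>_sym[OF q(1) p q(2)] \<tau>_sym[OF p q(1)] q(2) by metis
  then have "\<tau> p q \<in> \<real>" by (metis Reals_cnj_iff)
  then obtain t where t: "\<tau> p q = of_real t" by (auto elim: Reals_cases)
  have \<tau>_t: "\<rho> i j = of_real t * \<rho> i c * \<rho> c j" if "i \<in> V" "j \<in> V" "cls i \<noteq> cls j" for i j
  proof -
    have "\<tau> i j = of_real t"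
      using \<tau>_const[OF that p q(1)] q(2) t by simp
    then show ?thesis
      using V(4)[OF that(1)] V(3)[OF that(2)] by (simp add: \<tau>_def field_simps)
  qed
  have t0: "t \<noteq> 0"
  proof
    assume "t = 0"
    then have "\<rho> p q = 0"
      using \<tau>_t[OF p q(1)] q(2) by simp
    then show False
      using \<rho>_nonzero[OF V(1)[OF p] V(1)[OF q(1)]] q(2) by simp
  qed
  \<comment> \<open>On the class of \<open>c\<close> the entry \<open>\<rho> i c\<close> is 0; there
    \<open>lam i\<close> solves \<open>\<rho> i p = t * lam i * cnj (lam p)\<close>, where
    \<open>cnj (lam p) = \<rho> c p\<close>.\<close>
  define lam where "lam i = (if i \<in> V then \<rho> i c else \<rho> i p / (of_real t * \<rho> c p))" for i
  have lam0: "lam i \<noteq> 0" if "i \<in> U" for i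
    using that t0 V(3,4) V(1)[OF p] V(2)[OF p] p \<rho>_nonzero[of i p]
    by (cases "i \<in> V") (simp_all add: lam_def V_def)
  have mixed: "\<rho> i j = of_real t * lam i * cnj (lam j)" if "i \<in> U" "i \<notin> V" "j \<in> V" for i j
  proof -
    have "cls i = cls c" using that by (simp add: V_def)
    then have "\<rho> i j * \<rho> c p = \<rho> i p * \<rho> c j"
      using that(1) V(1,2)[OF that(3)] V(1,2)[OF p] by (intro minor) auto
    moreover have "cnj (lam j) = \<rho> c j"
      using that(3) V(1)[OF that(3)] c \<rho>_cnj[of j c] by (simp add: lam_def)
    ultimately show ?thesis
      using that(2) V(3)[OF p] t0 by (simp add: lam_def field_simps)
  qed
  have main: "\<rho> i j = of_real t * lam i * cnj (lam j)" if "i \<in> U" "j \<in> U" "cls i \<noteq> cls j" for i j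
  proof (cases "i \<in> V"; cases "j \<in> V")
    assume ij: "i \<in> V" "j \<in> V"
    then have "cnj (lam j) = \<rho> c j"
      using that c \<rho>_cnj[of j c] by (simp add: lam_def)
    then show ?thesis
      using \<tau>_t[OF ij that(3)] ij by (simp add: lam_def)
  next
    assume ij: "i \<in> V" "j \<notin> V"
    then have "\<rho> j i = of_real t * lam j * cnj (lam i)"
      using that by (intro mixed)
    then show ?thesis
      using \<rho>_cnj[of j i] that by (simp add: mult_ac)
  next
    assume "i \<notin> V" "j \<notin> V"
    then show ?thesis using that by (simp add: V_def)
  qed (use that mixed in auto)
  have "G i j = of_real t * lam i * cnj (lam j) * G' i j" if "i \<in> U" "j \<in> U" for i j
  proof (cases "cls i = cls j")
    case True
    then show ?thesis using zero[OF that] zero'[OF that] by simp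
  next
    case False
    then show ?thesis
      using main[OF that False] zero'[OF that] by (simp add: \<rho>_def field_simps)
  qed
  with t0 lam0 show thesis by (rule that)
qed

end

section \<open>Hermitian forms of signature \<open>(n-1,1)\<close>\<close>

lemma hform_hdual: "hform H v w = (\<Sum>k\<in>UNIV. hdual H v $ k * w $ k)"
  unfolding hform_def hdual_def by (subst sum.swap) (simp add: sum_distrib_right)

lemma hform_add_right: "hform H u (v + w) = hform H u v + hform H u w"
  by (simp add: hform_hdual sum.distrib distrib_left)

lemma hform_diff_right: "hform H u (v - w) = hform H u v - hform H u w"
  by (simp add: hform_hdual sum_subtractf right_diff_distrib)

lemma hform_scale_right: "hform H u (c *s w) = c * hform H u w"
  by (simp add: hform_hdual sum_distrib_left mult_ac)

lemma hform_zero_right [simp]: "hform H u 0 = 0"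
  by (simp add: hform_hdual)

lemma hdual_add: "hdual H (u + v) = hdual H u + hdual H v"
  by (simp add: hdual_def vec_eq_iff sum.distrib distrib_right)

lemma hdual_diff: "hdual H (u - v) = hdual H u - hdual H v"
  by (simp add: hdual_def vec_eq_iff sum_subtractf left_diff_distrib)

lemma hdual_scale: "hdual H (c *s u) = cnj c *s hdual H u"
  by (simp add: hdual_def vec_eq_iff sum_distrib_left mult_ac)

lemma hform_add_left: "hform H (u + v) w = hform H u w + hform H v w"
  by (simp add: hform_hdual hdual_add sum.distrib distrib_right)

lemma hform_diff_left: "hform H (u - v) w = hform H u w - hform H v w"
  by (simp add: hform_hdual hdual_diff sum_subtractf left_diff_distrib)

lemma hform_scale_left: "hform H (c *s u) w = cnj c * hform H u w"
  by (simp add: hform_hdual hdual_scale sum_distrib_left mult_ac)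

lemma hform_zero_left [simp]: "hform H 0 w = 0"
  by (simp add: hform_def)

lemma hform_sum_right: "hform H u (\<Sum>i\<in>I. f i) = (\<Sum>i\<in>I. hform H u (f i))"
  by (induction I rule: infinite_finite_induct) (auto simp: hform_add_right)

lemma hform_sum_left: "hform H (\<Sum>i\<in>I. f i) w = (\<Sum>i\<in>I. hform H (f i) w)"
  by (induction I rule: infinite_finite_induct) (auto simp: hform_add_left)

lemmas hform_simps = hform_add_left hform_add_right hform_diff_left hform_diff_right
  hform_scale_left hform_scale_right

section \<open>Isometries and rank-one operators\<close>

definition rank_one :: "complex^'n^'n \<Rightarrow> complex^'n \<Rightarrow> complex^'n \<Rightarrow> complex^'n^'n" where
  "rank_one H d e = (\<chi> i j. d $ i * hdual H e $ j)"

lemma rank_one_mult: "rank_one H d e *v x = hform H e x *s d"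
  by (simp add: rank_one_def matrix_vector_mult_def vec_eq_iff hform_hdual sum_distrib_left
      sum_distrib_right mult_ac)

text \<open>The determinant is left free: reflections need not have determinant 1, and the unit
  scalar that corrects it moves no line.\<close>

definition isometry :: "complex^'n^'n \<Rightarrow> complex^'n^'n \<Rightarrow> bool" where
  "isometry H g \<longleftrightarrow> (\<forall>v w. hform H (g *v v) (g *v w) = hform H v w)"

lemma isometryD: "isometry H g \<Longrightarrow> hform H (g *v v) (g *v w) = hform H v w"
  by (simp add: isometry_def)

lemma isometry_mult: "isometry H g \<Longrightarrow> isometry H g' \<Longrightarrow> isometry H (g ** g')"
  by (simp add: isometry_def flip: matrix_vector_mul_assoc)

lemma scalar_matrix_mult: "(mat c ** g) *v x = c *s (g *v x)"
  for g :: "complex^'n^'n"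
proof -
  have "mat c *v y = c *s y" for y :: "complex^'n"
    by (simp add: matrix_vector_mult_def mat_def vec_eq_iff if_distrib[of "\<lambda>z. z * _"] cong: if_cong)
  then show ?thesis by (simp flip: matrix_vector_mul_assoc)
qed

lemma det_scalar: "det (mat c :: complex^'n^'n) = c ^ CARD('n)"
  by (subst det_diagonal) (simp_all add: mat_def)

lemma det_cnj: "det (\<chi> i j. cnj (A $ i $ j)) = cnj (det A)"
  for A :: "complex^'n^'n"
  by (simp add: det_def)

locale lorentz =
  fixes H :: "complex^'n^'n"
  assumes hermitian: "hermitian_mat H" and signature: "signature_n1_1 H"
begin

abbreviation h where "h \<equiv> hform H"

lemma h_cnj: "h w v = cnj (h v w)"
proof -
  have "cnj (H $ j $ k) = H $ k $ j" for j k
    using hermitian by (metis hermitian_mat_def complex_cnj_cnj)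
  then show ?thesis
    unfolding hform_def by (subst sum.swap) (simp add: mult_ac)
qed

lemma h_zero_sym: "h v w = 0 \<longleftrightarrow> h w v = 0"
  by (metis h_cnj complex_cnj_zero)

lemma h_diag: "h v v = of_real (Re (h v v))"
  using h_cnj[of v v] by (metis Reals_cnj_iff of_real_Re)

text \<open>The signature enters later arguments only through this vector, the negative column of a
  diagonalising basis: a vector orthogonal to it has no coordinate with a negative square.\<close>

lemma timelike_vector:
  obtains e where "h e e = -1" "\<And>u. h e u = 0 \<Longrightarrow> u \<noteq> 0 \<Longrightarrow> Re (h u u) > 0"
proof -
  obtain A :: "complex^'n^'n" and j0 where A: "invertible A" and
    diag: "\<And>j k. h (column j A) (column k A) = (if j \<noteq> k then 0 else if j = j0 then -1 else 1)"
    using signature unfolding signature_n1_1_def by blast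
  have left: "h (column j A) (A *v x) = (if j = j0 then - (x $ j) else x $ j)" for j x
  proof -
    have "h (column j A) (A *v x) =
        (\<Sum>k\<in>UNIV. if j = k then (if j = j0 then - (x $ k) else x $ k) else 0)"
      unfolding matrix_mult_sum hform_sum_right hform_scale_right diag
      by (intro sum.cong) auto
    then show ?thesis by simp
  qed
  have square: "h (A *v x) (A *v x) =
      of_real (\<Sum>j\<in>UNIV. if j = j0 then - (cmod (x $ j))\<^sup>2 else (cmod (x $ j))\<^sup>2)" for x
  proof -
    have "h (A *v x) (A *v x) = (\<Sum>j\<in>UNIV. cnj (x $ j) * h (column j A) (A *v x))"
      by (subst (1) matrix_mult_sum) (simp add: hform_sum_left hform_scale_left)
    also have "\<dots> = of_real (\<Sum>j\<in>UNIV. if j = j0 then - (cmod (x $ j))\<^sup>2 else (cmod (x $ j))\<^sup>2)"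
      unfolding of_real_sum left
      by (intro sum.cong) (auto simp: mult.commute complex_norm_square simp del: of_real_power)
    finally show ?thesis .
  qed
  show thesis
  proof (rule that)
    show "h (column j0 A) (column j0 A) = -1" by (simp add: diag)
    fix u assume u: "h (column j0 A) u = 0" "u \<noteq> 0"
    obtain B where B: "A ** B = mat 1" using A unfolding invertible_def by blast
    define x where "x = B *v u"
    have ux: "u = A *v x" by (simp add: x_def matrix_vector_mul_assoc B)
    then have x0: "x $ j0 = 0" using u(1) by (simp add: left)
    have "x \<noteq> 0" using u(2) ux by auto
    then obtain i where i: "x $ i \<noteq> 0" by (auto simp: vec_eq_iff)
    have "(\<Sum>j\<in>UNIV. if j = j0 then - (cmod (x $ j))\<^sup>2 else (cmod (x $ j))\<^sup>2) > 0"
      using i x0 by (intro sum_pos2[of _ i]) auto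
    then show "Re (h u u) > 0"
      unfolding ux square by simp
  qed
qed

section \<open>Isotropic vectors and hyperbolic planes\<close>

lemma isotropic_not_orth_timelike:
  assumes "\<And>u. h e u = 0 \<Longrightarrow> u \<noteq> 0 \<Longrightarrow> Re (h u u) > 0" "h a a = 0" "a \<noteq> 0"
  shows "h e a \<noteq> 0"
  using assms(1)[of a] assms(2,3) by auto

text \<open>Eliminating the \<open>e\<close>-component from \<open>a\<close> and \<open>b\<close>
  leaves a combination \<open>u\<close> that is orthogonal to \<open>e\<close> and still of norm 0;
  positivity forces \<open>u = 0\<close>.\<close>

lemma isotropic_orth_proportional:
  assumes "h a a = 0" "h b b = 0" "h a b = 0" "a \<noteq> 0" "b \<noteq> 0"
  obtains c where "c \<noteq> 0" "b = c *s a"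
proof -
  obtain e where e: "\<And>u. h e u = 0 \<Longrightarrow> u \<noteq> 0 \<Longrightarrow> Re (h u u) > 0"
    using timelike_vector by blast
  have ea: "h e a \<noteq> 0" and eb: "h e b \<noteq> 0"
    using isotropic_not_orth_timelike[OF e] assms by blast+
  define u where "u = h e a *s b - h e b *s a"
  have "h b a = 0" using assms(3) h_zero_sym by blast
  then have "h e u = 0" "h u u = 0"
    using assms by (simp_all add: u_def hform_simps)
  then have "u = 0" using e by fastforce
  then have "inverse (h e a) *s (h e a *s b) = inverse (h e a) *s (h e b *s a)"
    by (simp add: u_def)
  then have "b = (h e b / h e a) *s a"
    using ea by (simp add: vector_smult_assoc field_simps)
  then show thesis
    using that[of "h e b / h e a"] ea eb by simp
qed

text \<open>Adding a multiple of \<open>a\<close> changes no norm on the complement of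
  \<open>a\<close>. A \<open>w\<close> of norm \<le> 0 could thus be made orthogonal to a timelike
  \<open>e\<close> and would become 0, so \<open>w\<close> would be a multiple of \<open>a\<close>,
  which \<open>b\<close> excludes.\<close>

lemma orth_isotropic_pos:
  assumes "h a a = 0" "h a b \<noteq> 0" "h a w = 0" "h b w = 0" "w \<noteq> 0"
  shows "Re (h w w) > 0"
proof (rule ccontr)
  assume neg: "\<not> Re (h w w) > 0"
  obtain e where e: "\<And>u. h e u = 0 \<Longrightarrow> u \<noteq> 0 \<Longrightarrow> Re (h u u) > 0"
    using timelike_vector by blast
  have "a \<noteq> 0" using assms(2) by auto
  then have ea: "h e a \<noteq> 0"
    using isotropic_not_orth_timelike[OF e] assms by blast
  define u where "u = h e a *s w - h e w *s a"
  have "h w a = 0" using assms(3) h_zero_sym by blast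
  then have "h u u = cnj (h e a) * h e a * h w w" "h e u = 0"
    using assms by (simp_all add: u_def hform_simps mult_ac)
  then have "h u u = of_real ((cmod (h e a))\<^sup>2 * Re (h w w))"
    by (metis h_diag[of w] complex_norm_square mult.commute of_real_mult)
  then have "Re (h u u) = (cmod (h e a))\<^sup>2 * Re (h w w)" by simp
  then have "Re (h u u) \<le> 0"
    using neg by (simp add: mult_nonneg_nonpos)
  then have "u = 0" using e[OF \<open>h e u = 0\<close>] by fastforce
  then have "inverse (h e a) *s (h e a *s w) = inverse (h e a) *s (h e w *s a)"
    by (simp add: u_def)
  then have w: "w = (h e w / h e a) *s a"
    using ea by (simp add: vector_smult_assoc field_simps)
  have "h b a \<noteq> 0" using assms(2) h_zero_sym by blast
  moreover have "(h e w / h e a) * h b a = 0"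
    using assms(4) w by (metis hform_scale_right)
  ultimately have "h e w / h e a = 0" by simp
  then have "w = 0 *s a" using w by (simp only:)
  then show False using assms(5) by simp
qed

lemma nondegenerate:
  assumes "\<And>u. h u x = 0"
  shows "x = 0"
proof -
  obtain e where "\<And>u. h e u = 0 \<Longrightarrow> u \<noteq> 0 \<Longrightarrow> Re (h u u) > 0"
    using timelike_vector by blast
  then show ?thesis using assms[of e] assms[of x] by force
qed

section \<open>Determinants of isometries\<close>

lemma det_nonzero: "det H \<noteq> 0"
proof -
  have "x = 0" if "H *v x = 0" for x
  proof (rule nondegenerate)
    fix u
    have "h u x = (\<Sum>j\<in>UNIV. cnj (u $ j) * (H *v x) $ j)"
      by (simp add: hform_def matrix_vector_mult_def sum_distrib_left mult.assoc)
    then show "h u x = 0" using that by simp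
  qed
  then show ?thesis
    using invertible_det_nz invertible_left_inverse matrix_left_invertible_ker by metis
qed

text \<open>In matrix terms an isometry satisfies \<open>?g ** (H ** g) = H\<close> with
  \<open>?g\<close> the conjugate transpose; taking determinants and cancelling \<open>det H\<close>
  gives the claim.\<close>

lemma isometry_det:
  assumes "isometry H g"
  shows "cmod (det g) = 1"
proof -
  let ?g = "\<chi> i j. cnj (transpose g $ i $ j)"
  have col: "(g *v axis i 1) $ k = g $ k $ i" for i k
    by (simp add: matrix_vector_mult_def axis_def if_distrib[of "\<lambda>z. _ * z"] cong: if_cong)
  have entry: "h (g *v axis i 1) (g *v axis j 1) = (?g ** (H ** g)) $ i $ j" for i j
    by (simp add: hform_def matrix_matrix_mult_def transpose_def col sum_distrib_left mult.assoc)
  have entry1: "h (axis i 1) (axis j 1) = H $ i $ j" for i j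
    by (simp add: hform_def axis_def if_distrib[of cnj] if_distrib[of "\<lambda>z. z * _"]
        if_distrib[of "\<lambda>z. _ * z"] sum.delta cong: if_cong)
  have "?g ** (H ** g) = H"
    using isometryD[OF assms] by (simp add: vec_eq_iff flip: entry entry1)
  then have "det ?g * (det H * det g) = det H"
    by (metis det_mul)
  moreover have "det ?g = cnj (det g)"
    by (simp only: det_cnj det_transpose)
  ultimately have "cnj (det g) * det g = 1"
    using det_nonzero by (simp add: field_simps)
  then have "of_real ((cmod (det g))\<^sup>2) = (1 :: complex)"
    by (metis complex_norm_square mult.commute)
  then have "(cmod (det g))\<^sup>2 = 1" by (simp only: of_real_eq_1_iff)
  then show ?thesis by (simp add: power2_eq_1_iff)
      (use norm_ge_zero[of "det g"] in linarith)
qed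

lemma isometry_SU:
  assumes "isometry H g"
  obtains c where "cmod c = 1" "mat c ** g \<in> SU_h H"
proof -
  let ?N = "CARD('n)"
  \<comment> \<open>An \<open>n\<close>-th root of \<open>inverse (det g)\<close>, which lies on the
    unit circle by \<open>isometry_det\<close>.\<close>
  define c where "c = cis (- Arg (det g) / ?N)"
  have "c ^ ?N = cis (- Arg (det g))"
    by (simp add: c_def Complex.DeMoivre)
  moreover have "det g = cis (Arg (det g))"
    using isometry_det[OF assms] rcis_cmod_Arg[of "det g"] by (simp add: rcis_def)
  ultimately have "c ^ ?N * det g = 1"
    by (metis add.left_inverse cis_mult cis_zero)
  then have "det (mat c ** g) = 1"
    by (simp add: det_mul det_scalar)
  moreover have "cnj c * c = 1"
    by (simp add: c_def cis_cnj cis_mult)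
  then have "cnj c * (c * z) = z" for z
    by (metis mult.assoc mult_1)
  then have "h ((mat c ** g) *v v) ((mat c ** g) *v w) = h v w" for v w
    using isometryD[OF assms] by (simp add: scalar_matrix_mult hform_simps mult.left_commute)
  moreover have "cmod c = 1" by (simp add: c_def)
  ultimately show thesis using that by (simp add: SU_h_def)
qed

section \<open>Reflections and Witt's theorem\<close>

lemma reflection:
  assumes norm: "h w w = h w' w'" and c0: "h (w - w') w \<noteq> 0"
  obtains g where "isometry H g" "g *v w = w'" "\<And>x. h (w - w') x = 0 \<Longrightarrow> g *v x = x"
proof -
  define d where "d = w - w'"
  define c where "c = h d w"
  have c: "c \<noteq> 0" using c0 by (simp add: c_def d_def)
  \<comment> \<open>Dividing by \<open>h d w\<close> instead of \<open>h d d\<close> keeps the map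
    defined for isotropic \<open>d\<close>. Equality of the norms gives
    \<open>h d d = c + cnj c\<close>, which is exactly what makes it an isometry.\<close>
  define g where "g = mat 1 - rank_one H (inverse c *s d) d"
  have g: "g *v x = x - (h d x / c) *s d" for x
    by (simp add: g_def matrix_vector_mult_diff_rdistrib rank_one_mult vector_smult_assoc
        divide_inverse)
  have dd: "h d d = c + cnj c"
    using norm h_cnj[of w w'] by (simp add: c_def d_def hform_simps h_cnj[symmetric])
  have "h (g *v x) (g *v y) = h x y" for x y
  proof -
    have xd: "h x d = cnj (h d x)" by (rule h_cnj)
    have "h (g *v x) (g *v y) = h x y - cnj (h d x) * h d y / c - cnj (h d x) * h d y / cnj c
        + cnj (h d x) * h d y * h d d / (c * cnj c)"
      by (simp add: g hform_simps xd algebra_simps)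
    also have "\<dots> = h x y"
      using c unfolding dd by (simp add: field_simps)
    finally show ?thesis .
  qed
  then have "isometry H g" by (simp add: isometry_def)
  moreover have "g *v w = w'"
    using c by (simp add: g c_def[symmetric]) (simp add: d_def)
  ultimately show thesis
    using that by (simp add: g d_def)
qed

text \<open>A reflection along \<open>a - a'\<close> requires \<open>h a' a \<noteq> 0\<close>.
  Otherwise \<open>a\<close> and \<open>a'\<close> span the same line, and two reflections lead
  through the isotropic vector \<open>b\<close> off that line.\<close>

lemma isometry_isotropic:
  assumes "h a a = 0" "h a' a' = 0" "h b b = 0" "h a b \<noteq> 0" "a' \<noteq> 0"
  obtains g where "isometry H g" "g *v a = a'"
proof (cases "h a' a = 0")
  case False
  then have "h (a - a') a \<noteq> 0" using assms(1) by (simp add: hform_simps)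
  then show thesis
    using reflection[of a a'] assms(1,2) that by metis
next
  case True
  have "a \<noteq> 0" using assms(4) by auto
  then obtain c where c: "c \<noteq> 0" "a = c *s a'"
    using isotropic_orth_proportional[OF assms(2,1) True assms(5)] by metis
  then have "h a' b \<noteq> 0" using assms(4) by (simp add: hform_simps)
  then have "h (b - a') b \<noteq> 0" using assms(3) by (simp add: hform_simps)
  then obtain g' where g': "isometry H g'" "g' *v b = a'"
    using reflection[of b a'] assms(2,3) by metis
  have "h b a \<noteq> 0" using assms(4) h_zero_sym by blast
  then have "h (a - b) a \<noteq> 0" using assms(1) by (simp add: hform_simps)
  then obtain g where "isometry H g" "g *v a = b"
    using reflection[of a b] assms(1,3) by metis
  with g' show thesis
    using that[of "g' ** g"] isometry_mult[of H g' g] by (simp flip: matrix_vector_mul_assoc)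
qed

text \<open>Once \<open>a\<close> has been moved to \<open>a'\<close>, the vector
  \<open>b1 - b'\<close> is orthogonal to \<open>a'\<close>, so the reflection taking
  \<open>b1\<close> to \<open>b'\<close> leaves \<open>a'\<close> in place.\<close>

lemma isometry_hyperbolic_pair:
  assumes "h a a = 0" "h b b = 0" "h a b \<noteq> 0" "h a' a' = 0" "h b' b' = 0" "h a' b' = h a b"
  obtains g where "isometry H g" "g *v a = a'" "g *v b = b'"
proof -
  have "a' \<noteq> 0" using assms by auto
  then obtain g where g: "isometry H g" "g *v a = a'"
    using isometry_isotropic assms(1-4) by metis
  define b1 where "b1 = g *v b"
  have b1: "h b1 b1 = 0" "h a' b1 = h a b"
    using isometryD[OF g(1)] g(2) assms(2) by (auto simp: b1_def)
  show thesis
  proof (cases "h b' b1 = 0")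
    case True
    have "b' \<noteq> 0" "b1 \<noteq> 0" using assms b1 by auto
    moreover have "h b1 b' = 0" using True h_zero_sym by blast
    ultimately obtain c where "b' = c *s b1"
      using isotropic_orth_proportional[of b1 b'] b1(1) assms(5) by metis
    then have "b' = b1"
      using assms(3,6) b1(2) by (simp add: hform_simps)
    then show thesis using that g b1_def by blast
  next
    case False
    then have "h (b1 - b') b1 \<noteq> 0" using b1 by (simp add: hform_simps)
    then obtain R where R: "isometry H R" "R *v b1 = b'"
      "\<And>x. h (b1 - b') x = 0 \<Longrightarrow> R *v x = x"
      using reflection[of b1 b'] b1(1) assms(5) by metis
    have "h a' (b1 - b') = 0" using assms(6) b1(2) by (simp add: hform_simps)
    then have "R *v a' = a'" using R(3) h_zero_sym by blast
    then show thesis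
      using that[of "R ** g"] isometry_mult[OF R(1) g(1)] R(2) g(2)
      by (simp add: b1_def flip: matrix_vector_mul_assoc)
  qed
qed

text \<open>Witt's theorem, by successively composing with reflections: once the hyperbolic pair is
  matched, all correcting vectors lie in a positive definite space.\<close>

lemma isometry_extension:
  assumes ab: "h a a = 0" "h b b = 0" "h a b \<noteq> 0" "h a' a' = 0" "h b' b' = 0" "h a' b' = h a b"
    and "finite I"
    and "\<And>i. i \<in> I \<Longrightarrow> h a' (v' i) = h a (v i)" "\<And>i. i \<in> I \<Longrightarrow> h b' (v' i) = h b (v i)"
    and "\<And>i j. i \<in> I \<Longrightarrow> j \<in> I \<Longrightarrow> h (v' i) (v' j) = h (v i) (v j)"
  shows "\<exists>g. isometry H g \<and> g *v a = a' \<and> g *v b = b' \<and> (\<forall>i\<in>I. g *v v i = v' i)"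
  using assms(7-)
proof (induction I rule: finite_induct)
  case empty
  then show ?case using isometry_hyperbolic_pair[OF ab] by auto
next
  case (insert k I)
  then obtain g where g: "isometry H g" "g *v a = a'" "g *v b = b'" "\<And>i. i \<in> I \<Longrightarrow> g *v v i = v' i"
    by (metis insertCI)
  define w where "w = g *v v k"
  let ?d = "w - v' k"
  \<comment> \<open>The correction \<open>?d\<close> is orthogonal to everything matched so far, so
    the reflection along it disturbs none of it.\<close>
  have orth: "h u ?d = 0" if "u = g *v x" "h u (v' k) = h x (v k)" for u x
    using that isometryD[OF g(1)] by (simp add: w_def hform_simps)
  have da: "h a' ?d = 0" using orth g(2) insert.prems(1) by auto
  have db: "h b' ?d = 0" using orth g(3) insert.prems(2) by auto
  have dv: "h (v' i) ?d = 0" if "i \<in> I" for i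
    using orth[of "v' i" "v i"] g(4)[OF that] insert.prems(3) that by auto
  have norm: "h w w = h (v' k) (v' k)"
    using isometryD[OF g(1)] insert.prems(3) by (simp add: w_def)
  show ?case
  proof (cases "?d = 0")
    case True
    then show ?thesis using g by (auto simp: w_def)
  next
    case False
    have "h a' b' \<noteq> 0" using ab by simp
    then have pos: "Re (h ?d ?d) > 0"
      using orth_isotropic_pos[OF ab(4) _ da db False] by blast
    \<comment> \<open>Equal norms make \<open>h ?d ?d\<close> twice the real part of
      \<open>h ?d w\<close>; positivity thus supplies the nonzero denominator of the
      reflection.\<close>
    have "h ?d ?d = h ?d w + cnj (h ?d w)"
      using norm by (simp add: hform_simps h_cnj[symmetric])
    then have "h ?d w \<noteq> 0" using pos by auto
    then obtain R where R: "isometry H R" "R *v w = v' k" "\<And>x. h ?d x = 0 \<Longrightarrow> R *v x = x"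
      using reflection[OF norm] by metis
    have fixed: "R *v u = u" if "h u ?d = 0" for u
      using R(3) that h_zero_sym by blast
    have "isometry H (R ** g)" using R(1) g(1) by (rule isometry_mult)
    moreover have "(R ** g) *v a = a'" "(R ** g) *v b = b'"
      using g fixed da db by (simp_all flip: matrix_vector_mul_assoc)
    moreover have "(R ** g) *v v i = v' i" if "i \<in> insert k I" for i
      using that g(4) fixed[OF dv] R(2) by (auto simp: w_def simp flip: matrix_vector_mul_assoc)
    ultimately show ?thesis by blast
  qed
qed

text \<open>Write \<open>c = p a + q b + w\<close> with \<open>w\<close> orthogonal to
  \<open>a\<close> and \<open>b\<close>. Isotropy of \<open>c\<close> makes the real part of
  \<open>z = cnj p * q * h a b\<close> equal to \<open>- h w w / 2\<close>, and the triple product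
  is the squared modulus of \<open>h a b\<close> times \<open>cnj z\<close>. Outside the span
  \<open>w\<close> is nonzero, hence of positive norm.\<close>

lemma Re_triple_product:
  assumes "h a a = 0" "h b b = 0" "h c c = 0" "h a b \<noteq> 0"
  shows "Re (h a b * h b c * h c a) \<le> 0"
    and "c \<notin> vec.span {a, b} \<Longrightarrow> Re (h a b * h b c * h c a) < 0"
proof -
  have ba: "h b a \<noteq> 0" using assms(4) h_zero_sym by blast
  define p q where "p = h b c / h b a" and "q = h a c / h a b"
  define w where "w = c - p *s a - q *s b"
  have aw: "h a w = 0" and bw: "h b w = 0"
    using assms ba by (simp_all add: w_def p_def q_def hform_simps)
  have wa: "h w a = 0" and wb: "h w b = 0" using aw bw h_zero_sym by blast+
  have c: "c = p *s a + q *s b + w" by (simp add: w_def)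
  define z where "z = cnj p * q * h a b"
  have "h c c = z + cnj z + h w w"
    unfolding z_def
    by (subst (1 2) c) (simp add: hform_simps aw bw wa wb assms(1,2) h_cnj[of a b] algebra_simps)
  then have "Re (h c c) = 2 * Re z + Re (h w w)" by simp
  then have sum: "Re z = - Re (h w w) / 2"
    using assms(3) by simp
  have "h b c = p * cnj (h a b)" "h c a = cnj q * cnj (h a b)"
    using ba assms(4) h_cnj[of a b] h_cnj[of a c] by (simp_all add: p_def q_def)
  then have "h a b * h b c * h c a = (h a b * cnj (h a b)) * cnj z"
    by (simp add: z_def mult_ac)
  also have "\<dots> = of_real ((cmod (h a b))\<^sup>2) * cnj z"
    by (simp only: complex_norm_square)
  finally have Re: "Re (h a b * h b c * h c a) = - ((cmod (h a b))\<^sup>2 * Re (h w w)) / 2"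
    using sum by (simp del: of_real_power)
  show "Re (h a b * h b c * h c a) \<le> 0"
    using orth_isotropic_pos[OF assms(1,4) aw bw] unfolding Re by (cases "w = 0") auto
  assume "c \<notin> vec.span {a, b}"
  moreover have "p *s a + q *s b \<in> vec.span {a, b}"
    by (intro vec.span_add vec.span_scale vec.span_base) auto
  ultimately have "w \<noteq> 0" using c by auto
  then show "Re (h a b * h b c * h c a) < 0"
    using orth_isotropic_pos[OF assms(1,4) aw bw] assms(4) unfolding Re by simp
qed

lemma isotropic_partner:
  assumes "h a a = 0" "a \<noteq> 0"
  obtains b where "h b b = 0" "h a b \<noteq> 0"
proof -
  obtain e where e: "h e e = -1" "\<And>u. h e u = 0 \<Longrightarrow> u \<noteq> 0 \<Longrightarrow> Re (h u u) > 0"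
    using timelike_vector by blast
  have ea: "h e a \<noteq> 0" using isotropic_not_orth_timelike[OF e(2)] assms by blast
  \<comment> \<open>The image of \<open>a\<close> under the reflection in \<open>e\<close>.\<close>
  define b where "b = a + (2 * h e a) *s e"
  have "h b b = 0" "h a b = 2 * h e a * cnj (h e a)"
    using assms(1) e(1) h_cnj[of e a] by (simp_all add: b_def hform_simps)
  then show thesis using that ea by simp
qed

end

section \<open>Semi-stability and degenerations\<close>

lemma polyfun_sum:
  "(\<And>i. i \<in> I \<Longrightarrow> F i \<in> polyfun r) \<Longrightarrow> (\<lambda>v phi. \<Sum>i\<in>I. F i v phi) \<in> polyfun r"
  by (induction I rule: infinite_finite_induct) (auto intro: polyfun.intros)

lemma polyfun_prod:
  "(\<And>i. i \<in> I \<Longrightarrow> F i \<in> polyfun r) \<Longrightarrow> (\<lambda>v phi. \<Prod>i\<in>I. F i v phi) \<in> polyfun r"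
  by (induction I rule: infinite_finite_induct) (auto intro: polyfun.intros)

lemma polyfun_cong:
  assumes "f \<in> polyfun r" "\<And>i. i < r \<Longrightarrow> v i = v' i" "\<And>i. i < r \<Longrightarrow> phi i = phi' i"
  shows "f v phi = f v' phi'"
  using assms(1) by induction (simp_all add: assms(2,3))

lemma polyfun_tendsto:
  assumes "f \<in> polyfun r" "\<And>i. i < r \<Longrightarrow> ((\<lambda>k. v k i) \<longlongrightarrow> v' i) F"
    "\<And>i. i < r \<Longrightarrow> ((\<lambda>k. phi k i) \<longlongrightarrow> phi' i) F"
  shows "((\<lambda>k. f (v k) (phi k)) \<longlongrightarrow> f v' phi') F"
  using assms(1) by induction (auto intro!: tendsto_intros assms(2,3))

lemma multihom_scale:
  assumes "f \<in> polyfun r" "multihom r k f"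
  shows "f (\<lambda>i. z i *s v i) (\<lambda>i. w i *s phi i) = (\<Prod>i<r. (z i * w i) ^ k) * f v phi"
proof -
  define V where "V m i = (if i < m then z i *s v i else v i)" for m i
  define P where "P m i = (if i < m then w i *s phi i else phi i)" for m i
  have "f (V m) (P m) = (\<Prod>i<m. (z i * w i) ^ k) * f v phi" if "m \<le> r" for m
    using that
  proof (induction m)
    case 0
    then show ?case by (simp add: V_def P_def)
  next
    case (Suc m)
    have "V (Suc m) = (V m)(m := z m *s V m m)" "P (Suc m) = (P m)(m := w m *s P m m)"
      by (auto simp: V_def P_def fun_eq_iff less_Suc_eq)
    then have "f (V (Suc m)) (P (Suc m)) = z m ^ k * (w m ^ k * f (V m) (P m))"
      using assms(2) Suc.prems unfolding multihom_def by (metis Suc_le_lessD)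
    then show ?case
      using Suc by (simp add: power_mult_distrib)
  qed
  from this[of r] have "f (V r) (P r) = (\<Prod>i<r. (z i * w i) ^ k) * f v phi" by simp
  moreover have "f (V r) (P r) = f (\<lambda>i. z i *s v i) (\<lambda>i. w i *s phi i)"
    by (rule polyfun_cong[OF assms(1)]) (simp_all add: V_def P_def)
  ultimately show ?thesis by simp
qed

lemma matrix_inv_det1:
  fixes g :: "complex^'n^'n"
  assumes "det g = 1"
  shows "g ** matrix_inv g = mat 1" "matrix_inv g ** g = mat 1"
proof -
  have "invertible g" using assms by (simp add: invertible_det_nz)
  then have "\<exists>B. g ** B = mat 1 \<and> B ** g = mat 1" by (simp add: invertible_def)
  then have "g ** matrix_inv g = mat 1 \<and> matrix_inv g ** g = mat 1"
    unfolding matrix_inv_def by (rule someI_ex)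
  then show "g ** matrix_inv g = mat 1" "matrix_inv g ** g = mat 1" by auto
qed

text \<open>Makes the passage from a line to its flag equivariant, so that an
  \<open>SL\<close>-invariant is constant along \<open>SU_h\<close>-orbits. It is invariance of
  \<open>h\<close>, tested on the standard basis.\<close>

lemma hdual_SU:
  assumes "g \<in> SU_h H"
  shows "hdual H (g *v u) = hdual H u v* matrix_inv g"
proof -
  have g: "det g = 1" "hform H (g *v u) (g *v w) = hform H u w" for w
    using assms by (auto simp: SU_h_def)
  have ax: "hform H x (axis j 1) = hdual H x $ j" for x j
    by (simp add: hform_hdual axis_def if_distrib[of "\<lambda>z. _ * z"] cong: if_cong)
  have col: "(g *v axis i 1) $ k = g $ k $ i" for i k
    by (simp add: matrix_vector_mult_def axis_def if_distrib[of "\<lambda>z. _ * z"] cong: if_cong)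
  have "(hdual H (g *v u) v* g) $ j = hform H (g *v u) (g *v axis j 1)" for j
    by (simp add: vector_matrix_mult_def hform_hdual col mult.commute)
  then have "hdual H (g *v u) v* g = hdual H u"
    by (simp add: vec_eq_iff g(2) ax)
  then have "hdual H u v* matrix_inv g = hdual H (g *v u) v* (g ** matrix_inv g)"
    by (metis vector_matrix_mul_assoc)
  then show ?thesis by (simp add: matrix_inv_det1 g(1))
qed

lemma SL_invariant_SU:
  assumes "SL_invariant f" "g \<in> SU_h H"
  shows "f (\<lambda>i. g *v v i) (\<lambda>i. hdual H (g *v v i)) = f v (\<lambda>i. hdual H (v i))"
  using assms by (simp add: SL_invariant_def SU_h_def hdual_SU[OF assms(2)])

lemma tendsto_hdual: "(f \<longlongrightarrow> l) F \<Longrightarrow> ((\<lambda>x. hdual H (f x)) \<longlongrightarrow> hdual H l) F"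
  unfolding hdual_def by (intro tendsto_intros)

lemma tendsto_smult:
  "(f \<longlongrightarrow> c) F \<Longrightarrow> (x \<longlongrightarrow> u) F \<Longrightarrow> ((\<lambda>k. f k *s x k) \<longlongrightarrow> c *s u) F"
  for x :: "'a \<Rightarrow> complex^'n"
  by (rule vec_tendstoI) (auto intro!: tendsto_intros)

text \<open>The product is itself the value of an invariant section of degree 1: contract each
  hyperplane with the line that \<open>\<sigma>\<close> assigns to it. The degree is 1 in every
  factor because a permutation hits each index once.\<close>

lemma s_der_semistable:
  assumes \<sigma>: "\<sigma> permutes {..<r}" and nz: "s_der H r v \<sigma> \<noteq> 0"
  shows "semistable H r v"
proof -
  define f where "f = (\<lambda>(v :: nat \<Rightarrow> complex^'a) phi. \<Prod>a<r. \<Sum>j\<in>UNIV. phi a $ j * v (\<sigma> a) $ j)"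
  have \<sigma>r: "\<sigma> a < r" if "a < r" for a
    using permutes_in_image[OF \<sigma>, of a] that by simp
  have "f \<in> polyfun r"
    unfolding f_def using \<sigma>r by (intro polyfun_prod polyfun_sum polyfun.intros) auto
  moreover have "multihom r 1 f"
    unfolding multihom_def
  proof (intro allI impI conjI)
    fix i c and v phi :: "nat \<Rightarrow> complex^'a"
    assume i: "i < r"
    have "f (v(i := c *s v i)) phi = (\<Prod>a<r. (if \<sigma> a = i then c else 1) * (\<Sum>j\<in>UNIV. phi a $ j * v (\<sigma> a) $ j))"
      unfolding f_def by (intro prod.cong) (auto simp: sum_distrib_left mult_ac)
    also have "\<dots> = (\<Prod>a<r. if \<sigma> a = i then c else 1) * f v phi"
      by (simp add: prod.distrib f_def)
    also have "(\<Prod>a<r. if \<sigma> a = i then c else 1) = (\<Prod>a<r. if a = i then c else 1)"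
      using prod.permute[OF \<sigma>, of "\<lambda>a. if a = i then c else 1"] by (simp add: comp_def)
    also have "\<dots> = c" using i by simp
    finally show "f (v(i := c *s v i)) phi = c ^ 1 * f v phi" by (simp only: power_one_right)
    have "f v (phi(i := c *s phi i)) = (\<Prod>a<r. (if a = i then c else 1) * (\<Sum>j\<in>UNIV. phi a $ j * v (\<sigma> a) $ j))"
      unfolding f_def by (intro prod.cong) (auto simp: sum_distrib_left mult_ac)
    also have "\<dots> = c * f v phi"
      using i by (simp add: prod.distrib f_def)
    finally show "f v (phi(i := c *s phi i)) = c ^ 1 * f v phi" by (simp only: power_one_right)
  qed
  moreover have "SL_invariant f"
    unfolding SL_invariant_def
  proof (intro allI impI)
    fix g :: "complex^'a^'a" and v phi :: "nat \<Rightarrow> complex^'a"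
    assume g: "det g = 1"
    have "(\<Sum>j\<in>UNIV. (y v* B) $ j * x $ j) = (\<Sum>i\<in>UNIV. y $ i * (B *v x) $ i)"
      for x y :: "complex^'a" and B
      by (simp add: vector_matrix_mult_def matrix_vector_mult_def sum_distrib_left sum_distrib_right,
          subst sum.swap) (simp add: mult_ac)
    moreover have "matrix_inv g *v (g *v x) = x" for x
      by (simp add: matrix_vector_mul_assoc matrix_inv_det1[OF g])
    ultimately show "f (\<lambda>i. g *v v i) (\<lambda>i. phi i v* matrix_inv g) = f v phi"
      by (simp add: f_def)
  qed
  moreover have "f v (\<lambda>i. hdual H (v i)) \<noteq> 0"
    using nz by (simp add: f_def s_der_def hform_hdual)
  ultimately show ?thesis
    unfolding semistable_def by (metis zero_less_one)
qed

text \<open>For isotropic lines orthogonal means equal, so this is the set of positions of line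
  \<open>i\<close>; the set itself serves as the colour of \<open>i\<close>.\<close>

definition line_class :: "complex^'n^'n \<Rightarrow> nat \<Rightarrow> (nat \<Rightarrow> complex^'n) \<Rightarrow> nat \<Rightarrow> nat set" where
  "line_class H r v i = {j. j < r \<and> hform H (v i) (v j) = 0}"

lemma derangement_extend:
  assumes "bij_betw f {..<r} {..<r}" "\<And>i. i < r \<Longrightarrow> f i \<noteq> i"
  obtains \<sigma> where "\<sigma> \<in> derangements r" "\<And>i. i < r \<Longrightarrow> \<sigma> i = f i"
proof -
  define \<sigma> where "\<sigma> i = (if i < r then f i else i)" for i
  have "bij_betw \<sigma> {..<r} {..<r}"
    using assms(1) by (subst bij_betw_cong[of _ _ f]) (auto simp: \<sigma>_def)
  then have "\<sigma> permutes {..<r}"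
    by (rule bij_imp_permutes) (simp add: \<sigma>_def)
  then have "\<sigma> \<in> derangements r"
    using assms(2) by (simp add: derangements_def \<sigma>_def)
  then show thesis using that by (simp add: \<sigma>_def)
qed

definition \<tau> :: "nat \<Rightarrow> complex" where "\<tau> k = of_real (inverse (real (Suc k)))"

lemma \<tau>_nonzero: "\<tau> k \<noteq> 0"
  by (simp add: \<tau>_def del: of_nat_Suc)

lemma cnj_\<tau>: "cnj (\<tau> k) = \<tau> k"
  by (simp add: \<tau>_def)

lemma \<tau>_tendsto: "\<tau> \<longlonglongrightarrow> 0"
proof -
  have "(\<lambda>k. of_real (inverse (real (Suc k)))) \<longlonglongrightarrow> (of_real 0 :: complex)"
    by (rule tendsto_of_real[OF LIMSEQ_inverse_real_of_nat])
  moreover have "\<tau> = (\<lambda>k. of_real (inverse (real (Suc k))))"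
    by (rule ext) (rule \<tau>_def)
  ultimately show ?thesis by (simp only: of_real_0)
qed

section \<open>Boosts and multiplicities of lines\<close>

context lorentz
begin

text \<open>The map scales \<open>a\<close> by \<open>t\<close> and \<open>b\<close> by
  \<open>1/t\<close> and fixes their common complement. Being an isometry comes down to
  \<open>(1 + \<alpha>) * (1 + \<beta>) = 1\<close>.\<close>

lemma boost:
  assumes "h a a = 0" "h b b = 0" "h a b \<noteq> 0" "t \<noteq> 0"
  obtains g where "isometry H g"
    "\<And>x. g *v x = x + (of_real (t - 1) * (h b x / h b a)) *s a
      + (of_real (1 / t - 1) * (h a x / h a b)) *s b"
proof -
  have ba: "h b a \<noteq> 0" using assms(3) h_zero_sym by blast
  define \<alpha> \<beta> :: complex where "\<alpha> = of_real (t - 1)" and "\<beta> = of_real (1 / t - 1)"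
  have \<alpha>\<beta>: "\<alpha> * \<beta> = - \<alpha> - \<beta>"
    using assms(4) by (simp add: \<alpha>_def \<beta>_def field_simps)
  have real: "cnj \<alpha> = \<alpha>" "cnj \<beta> = \<beta>" by (simp_all add: \<alpha>_def \<beta>_def)
  define P Q where "P x = h b x / h b a" and "Q x = h a x / h a b" for x
  have left: "h b x = P x * h b a" "h a x = Q x * h a b" for x
    using assms(3) ba by (simp_all add: P_def Q_def)
  have right: "h x b = cnj (P x) * h a b" "h x a = cnj (Q x) * h b a" for x
    using h_cnj[of x b] h_cnj[of x a]
    by (simp_all only: left(1)[of x] left(2)[of x] h_cnj[of a b, symmetric] h_cnj[of b a, symmetric]
        complex_cnj_mult)
  define g where "g = mat 1 + rank_one H ((\<alpha> / h b a) *s a) b + rank_one H ((\<beta> / h a b) *s b) a"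
  have g: "g *v x = x + (\<alpha> * P x) *s a + (\<beta> * Q x) *s b" for x
    by (simp add: g_def matrix_vector_mult_add_rdistrib rank_one_mult vector_smult_assoc P_def Q_def
        mult.commute)
  have "h (g *v x) (g *v y) = h x y" for x y
  proof -
    have "h (g *v x) (g *v y) = h x y + (cnj (Q x) * P y * h b a + cnj (P x) * Q y * h a b) *
        (\<alpha> + \<beta> + \<alpha> * \<beta>)"
      by (simp add: g hform_simps real assms(1,2) left(1)[of y] left(2)[of y] right(1)[of x] right(2)[of x]
          algebra_simps)
    then show ?thesis by (simp add: \<alpha>\<beta>)
  qed
  then have "isometry H g" by (simp add: isometry_def)
  then show thesis using that g by (simp add: \<alpha>_def \<beta>_def P_def Q_def)
qed

text \<open>As the parameter tends to 0, the line of \<open>a\<close> stays fixed while every line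
  not orthogonal to \<open>a\<close> is attracted to that of \<open>b\<close>. The units
  \<open>c k\<close> bring the determinant to 1.\<close>

lemma boost_sequence:
  assumes "h a a = 0" "h b b = 0" "h a b \<noteq> 0"
  shows "\<exists>g c. (\<forall>k. g k \<in> SU_h H \<and> cmod (c k) = 1 \<and> g k *v a = (c k * \<tau> k) *s a) \<and>
    (\<forall>x. (\<lambda>k. (cnj (c k) * \<tau> k) *s (g k *v x)) \<longlonglongrightarrow> (h a x / h a b) *s b)"
proof -
  define t where "t k = inverse (real (Suc k))" for k
  have t: "t k \<noteq> 0" for k by (simp add: t_def)
  have "\<exists>g c. isometry H g \<and> (\<forall>x. g *v x = x + (of_real (t k - 1) * (h b x / h b a)) *s a
      + (of_real (1 / t k - 1) * (h a x / h a b)) *s b) \<and> cmod c = 1 \<and> mat c ** g \<in> SU_h H" for k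
    using boost[OF assms(1-3) t[of k]] isometry_SU by metis
  then obtain g c where g: "\<And>k x. g k *v x = x + (of_real (t k - 1) * (h b x / h b a)) *s a
      + (of_real (1 / t k - 1) * (h a x / h a b)) *s b"
    and c: "\<And>k. cmod (c k) = 1" "\<And>k. mat (c k) ** g k \<in> SU_h H"
    by metis
  have cc: "cnj (c k) * c k = 1" for k
    using c(1)[of k] complex_norm_square[of "c k"] by (simp add: mult.commute)
  have ba: "h b a \<noteq> 0" using assms(3) h_zero_sym by blast
  show ?thesis
  proof (intro exI conjI allI)
    show "mat (c k) ** g k \<in> SU_h H" "cmod (c k) = 1" for k by (rule c)+
    have "g k *v a = of_real (t k) *s a" for k
      using ba assms(1) by (simp add: g vec_eq_iff algebra_simps)
    then show "(mat (c k) ** g k) *v a = (c k * \<tau> k) *s a" for k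
      by (simp add: scalar_matrix_mult vector_smult_assoc \<tau>_def t_def)
    fix x
    have t0: "(\<lambda>k. of_real (t k)) \<longlonglongrightarrow> (0 :: complex)"
    proof -
      have "(\<lambda>k. of_real (t k)) = \<tau>"
        by (rule ext) (simp add: \<tau>_def t_def)
      then show ?thesis using \<tau>_tendsto by simp
    qed
    \<comment> \<open>The factor \<open>cnj (c k)\<close> cancels the determinant correction, and
      \<open>\<tau> k\<close> cancels the growth \<open>1 / t k\<close> of the
      \<open>b\<close>-coefficient.\<close>
    have eq: "(cnj (c k) * \<tau> k) *s ((mat (c k) ** g k) *v x) =
        of_real (t k) *s x + (of_real (t k) * (of_real (t k) - 1) * (h b x / h b a)) *s a
        + ((1 - of_real (t k)) * (h a x / h a b)) *s b" (is "?L = ?R") for k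
    proof -
      have "?L = (cnj (c k) * c k * of_real (t k)) *s (g k *v x)"
        by (simp add: scalar_matrix_mult vector_smult_assoc \<tau>_def t_def mult_ac)
      also have "\<dots> = of_real (t k) *s (g k *v x)" by (simp add: cc)
      also have "\<dots> = ?R"
      proof -
        have T: "of_real (t k) * (of_real (1 / t k - 1) * q) = (1 - of_real (t k)) * q" for q :: complex
          using t[of k] by (simp add: field_simps)
        show ?thesis
          unfolding g vector_add_ldistrib vector_smult_assoc T by (simp add: mult.assoc)
      qed
      finally show ?thesis .
    qed
    have "(\<lambda>k. of_real (t k) *s x + (of_real (t k) * (of_real (t k) - 1) * (h b x / h b a)) *s a
        + ((1 - of_real (t k)) * (h a x / h a b)) *s b)
      \<longlonglongrightarrow> 0 *s x + (0 * (0 - 1) * (h b x / h b a)) *s a + ((1 - 0) * (h a x / h a b)) *s b"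
      by (intro tendsto_add tendsto_smult tendsto_mult tendsto_diff t0 tendsto_const)
    then show "(\<lambda>k. (cnj (c k) * \<tau> k) *s ((mat (c k) ** g k) *v x)) \<longlonglongrightarrow> (h a x / h a b) *s b"
      unfolding eq by simp
  qed
qed

lemma iso_tuple_proportional:
  assumes "iso_tuple H r v" "i < r" "j < r" "h (v i) (v j) = 0"
  obtains c where "c \<noteq> 0" "v j = c *s v i"
  using isotropic_orth_proportional[of "v i" "v j"] assms by (auto simp: iso_tuple_def)

lemma line_class_eq:
  assumes "iso_tuple H r v" "i < r" "j < r"
  shows "line_class H r v i = line_class H r v j \<longleftrightarrow> h (v i) (v j) = 0"
proof
  assume "line_class H r v i = line_class H r v j"
  moreover have "j \<in> line_class H r v j"
    using assms by (simp add: line_class_def iso_tuple_def)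
  ultimately show "h (v i) (v j) = 0" by (auto simp: line_class_def)
next
  assume "h (v i) (v j) = 0"
  then obtain c where "c \<noteq> 0" "v j = c *s v i"
    using iso_tuple_proportional[OF assms] by blast
  then show "line_class H r v i = line_class H r v j"
    by (simp add: line_class_def hform_simps)
qed

lemma line_class_fibre:
  assumes "iso_tuple H r v" "i < r"
  shows "{a\<in>{..<r}. line_class H r v a = line_class H r v i} = line_class H r v i"
  using line_class_eq[OF assms(1) _ assms(2)] h_zero_sym by (auto simp: line_class_def)

text \<open>\<open>P 0\<close> takes care of the colours \<open>x\<close> that no index has.\<close>

lemma fibre_bound:
  assumes "iso_tuple H r v" "\<And>i. i < r \<Longrightarrow> P (card (line_class H r v i))" "P 0"
  shows "P (card {a\<in>{..<r}. line_class H r v a = x})"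
proof (cases "{a\<in>{..<r}. line_class H r v a = x} = {}")
  case True
  then show ?thesis using assms(3) by (simp only: card.empty)
next
  case False
  then obtain i where "i < r" "line_class H r v i = x" by auto
  then show ?thesis
    using line_class_fibre[OF assms(1), of i] assms(2)[of i] by simp
qed

text \<open>Hilbert--Mumford for the boosts: with a line of multiplicity \<open>m > r/2\<close>, an invariant of
  degree \<open>(k,k)\<close> is \<open>t ^ (2 k (2 m - r))\<close> times a bounded quantity for every \<open>t > 0\<close>.\<close>

lemma semistable_multiplicity:
  assumes iso: "iso_tuple H r v" and ss: "semistable H r v" and i0: "i0 < r"
  shows "2 * card (line_class H r v i0) \<le> r"
proof (rule ccontr)
  assume big: "\<not> 2 * card (line_class H r v i0) \<le> r"
  let ?C = "line_class H r v i0" and ?a = "v i0"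
  have Cr: "?C \<subseteq> {..<r}" by (auto simp: line_class_def)
  have finC: "finite ?C" using Cr by (rule finite_subset) simp
  have cardC: "card ?C \<le> r" using card_mono[OF _ Cr] by simp
  obtain K f where K: "K > 0" and f: "f \<in> polyfun r" "multihom r K f" "SL_invariant f"
    and nz: "f v (\<lambda>i. hdual H (v i)) \<noteq> 0"
    using ss by (auto simp: semistable_def)
  have a: "h ?a ?a = 0" "?a \<noteq> 0" using iso i0 by (auto simp: iso_tuple_def)
  obtain b where b: "h b b = 0" "h ?a b \<noteq> 0" using isotropic_partner[OF a] .
  obtain g c where g: "\<And>k. g k \<in> SU_h H" and c: "\<And>k. cmod (c k) = 1"
    and ga: "\<And>k. g k *v ?a = (c k * \<tau> k) *s ?a"
    and lim: "\<And>x. (\<lambda>k. (cnj (c k) * \<tau> k) *s (g k *v x)) \<longlonglongrightarrow> (h ?a x / h ?a b) *s b"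
    using boost_sequence[OF a(1) b] by blast
  have \<tau>0: "\<tau> k \<noteq> 0" "cnj (\<tau> k) = \<tau> k" for k by (rule \<tau>_nonzero cnj_\<tau>)+
  have cc: "c k * cnj (c k) = 1" for k
    using c[of k] complex_norm_square[of "c k"] by simp
  \<comment> \<open>Each moved vector is written as a scalar \<open>s k i\<close> times a vector
    \<open>x k i\<close> that converges, so that the remaining value of \<open>f\<close> stays
    bounded.\<close>
  define x where "x k i = (if i \<in> ?C then v i else (cnj (c k) * \<tau> k) *s (g k *v v i))" for k i
  define x' where "x' i = (if i \<in> ?C then v i else (h ?a (v i) / h ?a b) *s b)" for i
  define s where "s k i = (if i \<in> ?C then c k * \<tau> k else c k / \<tau> k)" for k i
  have gv: "g k *v v i = s k i *s x k i" if "i < r" for k i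
  proof (cases "i \<in> ?C")
    case True
    then obtain z where "v i = z *s ?a"
      using iso_tuple_proportional[OF iso i0] that by (metis (mono_tags, lifting) line_class_def mem_Collect_eq)
    then show ?thesis
      using True ga[of k] by (simp add: s_def x_def vector_scalar_commute vector_smult_assoc mult_ac)
  next
    case False
    have "c k / \<tau> k * (cnj (c k) * \<tau> k) = 1" using \<tau>0(1)[of k] cc[of k] by simp
    then show ?thesis
      using False by (simp only: s_def x_def if_False vector_smult_assoc vector_smult_lid)
  qed
  have eq: "f v (\<lambda>i. hdual H (v i)) = (\<tau> k ^ 2) ^ (K * (2 * card ?C - r)) * f (x k) (\<lambda>i. hdual H (x k i))" for k
  proof -
    have "f v (\<lambda>i. hdual H (v i)) = f (\<lambda>i. g k *v v i) (\<lambda>i. hdual H (g k *v v i))"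
      using SL_invariant_SU[OF f(3) g] by simp
    also have "\<dots> = f (\<lambda>i. s k i *s x k i) (\<lambda>i. cnj (s k i) *s hdual H (x k i))"
      by (rule polyfun_cong[OF f(1)]) (simp_all add: gv hdual_scale)
    also have "\<dots> = (\<Prod>i<r. (s k i * cnj (s k i)) ^ K) * f (x k) (\<lambda>i. hdual H (x k i))"
      by (rule multihom_scale[OF f(1,2)])
    \<comment> \<open>A line in \<open>?C\<close> contributes \<open>\<tau> k ^ 2\<close> and any
      other its inverse; the surplus of contracted factors is \<open>2 * card ?C - r\<close>, a
      genuine difference by \<open>big\<close>.\<close>
    also have "(\<Prod>i<r. (s k i * cnj (s k i)) ^ K) = (\<tau> k ^ 2) ^ (K * (2 * card ?C - r))"
    proof -
      have sC: "s k i * cnj (s k i) = \<tau> k ^ 2" if "i \<in> ?C" for i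
      proof -
        have "s k i * cnj (s k i) = (c k * cnj (c k)) * (\<tau> k * \<tau> k)"
          using that by (simp add: s_def \<tau>0 mult_ac)
        then show ?thesis by (simp add: cc power2_eq_square)
      qed
      have sN: "s k i * cnj (s k i) = inverse (\<tau> k ^ 2)" if "i \<notin> ?C" for i
      proof -
        have "s k i * cnj (s k i) = (c k * cnj (c k)) / (\<tau> k * \<tau> k)"
          using that by (simp add: s_def \<tau>0)
        then show ?thesis by (simp add: cc power2_eq_square divide_inverse)
      qed
      have "(\<Prod>i<r. (s k i * cnj (s k i)) ^ K) =
          (\<Prod>i\<in>{..<r} - ?C. (s k i * cnj (s k i)) ^ K) * (\<Prod>i\<in>?C. (s k i * cnj (s k i)) ^ K)"
        by (rule prod.subset_diff[OF Cr]) simp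
      also have "\<dots> = (inverse (\<tau> k ^ 2) ^ K) ^ (r - card ?C) * ((\<tau> k ^ 2) ^ K) ^ card ?C"
        using sC sN finC Cr by (simp add: card_Diff_subset)
      also have "\<dots> = ((\<tau> k ^ 2) ^ K) ^ (2 * card ?C - r)"
      proof -
        have one: "inverse (\<tau> k ^ 2) ^ K * (\<tau> k ^ 2) ^ K = 1"
          using \<tau>0(1)[of k] by (simp flip: power_mult_distrib)
        have split: "card ?C = (r - card ?C) + (2 * card ?C - r)"
          using big cardC by simp
        have "p ^ (r - card ?C) * q ^ card ?C = (p * q) ^ (r - card ?C) * q ^ (2 * card ?C - r)"
          for p q :: complex
          by (subst (2) split) (simp only: power_add power_mult_distrib mult.assoc)
        then show ?thesis by (simp only: one power_one mult_1)
      qed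
      finally show ?thesis by (simp add: power_mult)
    qed
    finally show ?thesis .
  qed
  have xlim: "(\<lambda>k. x k i) \<longlonglongrightarrow> x' i" for i
    using lim by (cases "i \<in> ?C") (simp_all add: x_def x'_def)
  \<comment> \<open>By \<open>eq\<close> this sequence is the constant nonzero value of
    \<open>f\<close>, yet the positive power of \<open>\<tau> k\<close> drives it to 0.\<close>
  have "(\<lambda>k. (\<tau> k ^ 2) ^ (K * (2 * card ?C - r)) * f (x k) (\<lambda>i. hdual H (x k i)))
      \<longlonglongrightarrow> (0 ^ 2) ^ (K * (2 * card ?C - r)) * f x' (\<lambda>i. hdual H (x' i))"
    by (intro tendsto_mult tendsto_power \<tau>_tendsto polyfun_tendsto[OF f(1)] xlim tendsto_hdual)
  moreover have "K * (2 * card ?C - r) > 0" using K big by simp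
  ultimately have "(\<lambda>k::nat. f v (\<lambda>i. hdual H (v i))) \<longlonglongrightarrow> 0"
    by (simp only: eq[symmetric] zero_power2 zero_power mult_zero_left)
  then show False
    using nz LIMSEQ_unique tendsto_const by blast
qed

text \<open>The colouring is arbitrary so that the lemma serves both a semi-stable tuple and a
  two-coloured limit. Avoiding one's own colour already excludes fixed points.\<close>

lemma nonvanishing_derangement:
  assumes "\<And>i j. i < r \<Longrightarrow> j < r \<Longrightarrow> h (v i) (v j) = 0 \<longleftrightarrow> cls i = cls j"
    and "\<And>x. 2 * card {a\<in>{..<r}. cls a = x} \<le> r"
  obtains \<sigma> where "\<sigma> \<in> derangements r" "s_der H r v \<sigma> \<noteq> 0"
proof -
  obtain f where f: "bij_betw f {..<r} {..<r}" "\<And>i. i < r \<Longrightarrow> cls (f i) \<noteq> cls i"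
  proof (rule colour_avoiding_bij[of "{..<r}" "{..<r}" cls])
    show "card {a\<in>{..<r}. cls a = x} + card {b\<in>{..<r}. cls b = x} \<le> card {..<r}" for x
      using assms(2)[of x] by simp
  qed auto
  obtain \<sigma> where \<sigma>: "\<sigma> \<in> derangements r" "\<And>i. i < r \<Longrightarrow> \<sigma> i = f i"
    using derangement_extend[OF f(1)] f(2) by metis
  have "f i < r" if "i < r" for i
    using f(1) that by (auto simp: bij_betw_def)
  then have "s_der H r v \<sigma> \<noteq> 0"
    using f(2) assms(1) by (force simp: s_der_def \<sigma>(2))
  with \<sigma>(1) show thesis by (rule that)
qed

lemma Xss_multiplicity:
  assumes "Xss H r v"
  shows "2 * card {a\<in>{..<r}. line_class H r v a = x} \<le> r"
  using assms semistable_multiplicity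
  by (intro fibre_bound[of r v "\<lambda>m. 2 * m \<le> r"]) (auto simp: Xss_def)

lemma Xss_nonvanishing:
  assumes "Xss H r v"
  obtains \<sigma> where "\<sigma> \<in> derangements r" "s_der H r v \<sigma> \<noteq> 0"
proof (rule nonvanishing_derangement[of r v "line_class H r v"])
  show "h (v i) (v j) = 0 \<longleftrightarrow> line_class H r v i = line_class H r v j" if "i < r" "j < r" for i j
    using line_class_eq assms that by (simp add: Xss_def)
qed (use that Xss_multiplicity[OF assms] in auto)

text \<open>A line of multiplicity \<open>r/2\<close> lets the tuple degenerate, under the boosts, to one that
  consists of two lines only.\<close>

lemma closed_orbit_multiplicity:
  assumes X: "Xss H r v" and closed: "closed_orbit H r v" and dim: "vec.dim (v ` {..<r}) \<ge> 3"
    and i0: "i0 < r"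
  shows "2 * card (line_class H r v i0) < r"
proof (rule ccontr)
  let ?C = "line_class H r v i0" and ?a = "v i0"
  assume "\<not> 2 * card ?C < r"
  have iso: "iso_tuple H r v" using X by (simp add: Xss_def)
  have Cr: "?C \<subseteq> {..<r}" by (auto simp: line_class_def)
  have half: "2 * card ?C = r"
    using \<open>\<not> 2 * card ?C < r\<close> semistable_multiplicity[OF iso _ i0] X by (simp add: Xss_def)
  have "?C \<noteq> {..<r}"
  proof
    assume "?C = {..<r}"
    then have "card ?C = r" by simp
    then show False using half i0 by linarith
  qed
  then obtain j0 where j0: "j0 < r" "j0 \<notin> ?C" using Cr by auto
  let ?b = "v j0"
  have a: "h ?a ?a = 0" and b: "h ?b ?b = 0" using iso i0 j0 by (auto simp: iso_tuple_def)
  have ab: "h ?a ?b \<noteq> 0" using j0 by (simp add: line_class_def)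
  obtain g c where g: "\<And>k. g k \<in> SU_h H" and c: "\<And>k. cmod (c k) = 1"
    and ga: "\<And>k. g k *v ?a = (c k * \<tau> k) *s ?a"
    and lim: "\<And>x. (\<lambda>k. (cnj (c k) * \<tau> k) *s (g k *v x)) \<longlonglongrightarrow> (h ?a x / h ?a ?b) *s ?b"
    using boost_sequence[OF a b ab] by blast
  have c\<tau>: "c k * \<tau> k \<noteq> 0" for k using c[of k] \<tau>_nonzero[of k] by auto
  define w where "w i = (if i \<in> ?C then v i else (h ?a (v i) / h ?a ?b) *s ?b)" for i
  have onC: "\<exists>z. z \<noteq> 0 \<and> v i = z *s ?a" if "i \<in> ?C" for i
    using that iso_tuple_proportional[OF iso i0, of i] unfolding line_class_def by blast
  have "proj_conv r (\<lambda>k i. g k *v v i) w"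
    unfolding proj_conv_def
  proof (intro allI impI)
    fix i assume "i < r"
    show "\<exists>d. (\<lambda>k. d k *s (g k *v v i)) \<longlonglongrightarrow> w i"
    proof (cases "i \<in> ?C")
      case True
      then obtain z where z: "v i = z *s ?a" using onC by blast
      have "inverse (c k * \<tau> k) *s (g k *v v i) = w i" for k
      proof -
        have "inverse (c k * \<tau> k) *s (g k *v v i) = (z * (inverse (c k * \<tau> k) * (c k * \<tau> k))) *s ?a"
          unfolding z by (simp only: vector_scalar_commute ga vector_smult_assoc mult_ac)
        also have "inverse (c k * \<tau> k) * (c k * \<tau> k) = 1"
          using c\<tau>[of k] by (rule left_inverse)
        finally show ?thesis using True z by (simp add: w_def)
      qed
      then have "(\<lambda>k. inverse (c k * \<tau> k) *s (g k *v v i)) \<longlonglongrightarrow> w i" by simp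
      then show ?thesis by (rule exI[where x = "\<lambda>k. inverse (c k * \<tau> k)"])
    next
      case False
      then have "(\<lambda>k. (cnj (c k) * \<tau> k) *s (g k *v v i)) \<longlonglongrightarrow> w i"
        using lim[of "v i"] by (simp add: w_def)
      then show ?thesis by (rule exI[where x = "\<lambda>k. cnj (c k) * \<tau> k"])
    qed
  qed
  then have closure: "in_orbit_closure H r v w"
    using g unfolding in_orbit_closure_def by blast
  have wN: "w i = (h ?a (v i) / h ?a ?b) *s ?b" "h ?a (v i) / h ?a ?b \<noteq> 0" if "i < r" "i \<notin> ?C" for i
    using that ab by (auto simp: w_def line_class_def)
  have wC: "\<exists>z. z \<noteq> 0 \<and> w i = z *s ?a" if "i \<in> ?C" for i
    using onC[OF that] that by (simp add: w_def)
  have "?b \<noteq> 0" "?a \<noteq> 0" using ab by auto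
  have ba: "h ?b ?a \<noteq> 0" using ab h_zero_sym by blast
  have hw: "h (w i) (w j) = 0 \<longleftrightarrow> (i \<in> ?C) = (j \<in> ?C)" if "i < r" "j < r" for i j
  proof (cases "i \<in> ?C"; cases "j \<in> ?C")
    assume "i \<in> ?C" "j \<in> ?C"
    then show ?thesis using wC[of i] wC[of j] a by (auto simp: hform_simps)
  next
    assume "i \<in> ?C" "j \<notin> ?C"
    then show ?thesis using wC[of i] wN[of j] that ab by (auto simp: hform_simps)
  next
    assume "i \<notin> ?C" "j \<in> ?C"
    then show ?thesis using wC[of j] wN[of i] that ba ab by (auto simp: hform_simps)
  next
    assume "i \<notin> ?C" "j \<notin> ?C"
    then show ?thesis using wN[of i] wN[of j] that b by (simp add: hform_simps)
  qed
  have "w i \<noteq> 0" if "i < r" for i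
    using wC[of i] wN[of i] that \<open>?b \<noteq> 0\<close> \<open>?a \<noteq> 0\<close> by (cases "i \<in> ?C") (auto simp: vec_eq_iff)
  then have "iso_tuple H r w" using hw by (simp add: iso_tuple_def)
  \<comment> \<open>Both colours of the limit have exactly \<open>r/2\<close> indices, so it stays
    semi-stable and closedness of the orbit applies to it.\<close>
  moreover have "semistable H r w"
  proof -
    have "2 * card {i\<in>{..<r}. (i \<in> ?C) = y} \<le> r" for y
    proof (cases y)
      case True
      then have "{i\<in>{..<r}. (i \<in> ?C) = y} = ?C" using Cr by auto
      then show ?thesis using half by simp
    next
      case False
      then have "{i\<in>{..<r}. (i \<in> ?C) = y} = {..<r} - ?C" by auto
      moreover have "card ({..<r} - ?C) = r - card ?C"
        using Cr finite_subset[OF Cr] by (simp add: card_Diff_subset)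
      ultimately show ?thesis using half by simp
    qed
    then obtain \<sigma> where "\<sigma> \<in> derangements r" "s_der H r w \<sigma> \<noteq> 0"
      using nonvanishing_derangement[of r w "\<lambda>i. i \<in> ?C"] hw by metis
    then show ?thesis
      using s_der_semistable by (auto simp: derangements_def)
  qed
  ultimately have "same_orbit H r v w"
    using closed closure by (simp add: closed_orbit_def Xss_def)
  then obtain g where gSU: "g \<in> SU_h H" and "same_lines r (\<lambda>i. g *v v i) w"
    by (auto simp: same_orbit_def)
  then have gw: "\<exists>z. g *v v i = z *s w i" if "i < r" for i
    using that by (auto simp: same_lines_def)
  \<comment> \<open>An isometry cannot merge distinct lines: the indices outside \<open>?C\<close>
    are pairwise orthogonal in \<open>w\<close>, hence in \<open>v\<close>, so the original tuple
    has two lines only.\<close>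
  have "v i \<in> vec.span {?a, ?b}" if i: "i < r" for i
  proof (cases "i \<in> ?C")
    case True
    then obtain z where "v i = z *s ?a" using onC by blast
    then show ?thesis by (simp add: vec.span_scale vec.span_base)
  next
    case False
    obtain z z' where z: "g *v v i = z *s w i" "g *v ?b = z' *s w j0" using gw i j0 by metis
    have "h ?b (v i) = h (g *v ?b) (g *v v i)" using gSU by (simp add: SU_h_def)
    also have "\<dots> = 0" using hw[OF j0(1) i] j0(2) False by (simp add: z hform_simps)
    finally obtain z where "v i = z *s ?b"
      using iso_tuple_proportional[OF iso j0(1) i] by blast
    then show ?thesis by (simp add: vec.span_scale vec.span_base)
  qed
  then have "vec.dim (v ` {..<r}) \<le> card {?a, ?b}"
    by (intro vec.dim_le_card) auto
  also have "\<dots> \<le> 2" by (simp add: card_insert_if)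
  finally show False using dim by simp
qed

end

section \<open>Separation of orbits\<close>

lemma derangement_inv:
  assumes "\<sigma> \<in> derangements r"
  shows "inv \<sigma> \<in> derangements r"
proof -
  have \<sigma>: "\<sigma> permutes {..<r}" "\<And>i. i < r \<Longrightarrow> \<sigma> i \<noteq> i"
    using assms by (auto simp: derangements_def)
  then have "inv \<sigma> i \<noteq> i" if "i < r" for i
    using that permutes_inv_eq[OF \<sigma>(1), of i i] by auto
  then show ?thesis
    using permutes_inv[OF \<sigma>(1)] by (simp add: derangements_def)
qed

lemma derangement_inv_inv:
  assumes "\<sigma> \<in> derangements r"
  shows "inv (inv \<sigma>) = \<sigma>"
  using assms by (auto simp: derangements_def intro: inv_inv_eq permutes_bij)

lemma finite_derangements: "finite (derangements r)"
  by (rule finite_subset[of _ "{\<sigma>. \<sigma> permutes {..<r}}"])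
    (auto simp: derangements_def finite_permutations)

text \<open>A fixed-point-free involution matches the indices it raises with those it lowers, so
  \<open>r\<close> would be even.\<close>

lemma odd_derangement_inv_neq:
  assumes "odd r" and \<sigma>: "\<sigma> \<in> derangements r"
  shows "inv \<sigma> \<noteq> \<sigma>"
proof
  assume inv: "inv \<sigma> = \<sigma>"
  have perm: "\<sigma> permutes {..<r}" and neq: "\<And>i. i < r \<Longrightarrow> \<sigma> i \<noteq> i"
    using \<sigma> by (auto simp: derangements_def)
  have invol: "\<sigma> (\<sigma> i) = i" for i
    using permutes_inverses(1)[OF perm, of i] inv by simp
  have \<sigma>r: "\<sigma> i < r \<longleftrightarrow> i < r" for i
    using permutes_in_image[OF perm, of i] by simp
  let ?A = "{i. i < r \<and> i < \<sigma> i}" and ?B = "{i. i < r \<and> \<sigma> i < i}"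
  have "bij_betw \<sigma> ?A ?B"
    by (rule bij_betw_byWitness[where f' = \<sigma>]) (auto simp: invol \<sigma>r)
  then have "card ?A = card ?B" by (rule bij_betw_same_card)
  moreover have "?A \<union> ?B = {..<r}"
    using neq by (auto simp: neq_iff)
  then have "card (?A \<union> ?B) = r" by simp
  moreover have "card (?A \<union> ?B) = card ?A + card ?B"
    by (rule card_Un_disjoint) auto
  ultimately show False using assms(1) by presburger
qed

text \<open>\<open>D\<close> and its set of inverses are disjoint and have together at least
  \<open>card (derangements r) - 1\<close> elements; a missing pair \<open>\<sigma>\<close>,
  \<open>inv \<sigma>\<close> would be two more, too many even if \<open>div 2\<close> rounds
  down.\<close>

lemma derangement_half_cover:
  assumes "odd r" and D: "D \<subseteq> derangements r" "card D = card (derangements r) div 2"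
    "\<And>\<sigma>. \<sigma> \<in> D \<Longrightarrow> inv \<sigma> \<notin> D" and \<sigma>: "\<sigma> \<in> derangements r"
  shows "\<sigma> \<in> D \<or> inv \<sigma> \<in> D"
proof (rule ccontr)
  assume not: "\<not> (\<sigma> \<in> D \<or> inv \<sigma> \<in> D)"
  have finD: "finite D" using D(1) finite_derangements by (rule finite_subset)
  have inj: "inj_on inv D"
    using D(1) derangement_inv_inv by (metis inj_onI subsetD)
  have "card (D \<union> inv ` D) = card D + card (inv ` D)"
    using D(3) finD by (intro card_Un_disjoint) auto
  also have "card (inv ` D) = card D" using inj by (rule card_image)
  finally have DD: "card (D \<union> inv ` D) = 2 * card D" by simp
  have inv_D: "inv (inv \<rho>) = \<rho>" if "\<rho> \<in> D" for \<rho>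
    using derangement_inv_inv that D(1) by blast
  have "\<sigma> \<notin> inv ` D"
    using inv_D not by auto
  moreover have "inv \<sigma> \<notin> inv ` D"
    using inv_D not derangement_inv_inv[OF \<sigma>] by (metis imageE)
  ultimately have inv_notin: "\<sigma> \<notin> inv ` D" "inv \<sigma> \<notin> inv ` D" .
  have "card ({\<sigma>, inv \<sigma>} \<union> (D \<union> inv ` D)) = card {\<sigma>, inv \<sigma>} + card (D \<union> inv ` D)"
    using not inv_notin finD by (intro card_Un_disjoint) auto
  moreover have "card {\<sigma>, inv \<sigma>} = 2"
    using odd_derangement_inv_neq[OF assms(1) \<sigma>] by simp
  moreover have "{\<sigma>, inv \<sigma>} \<union> (D \<union> inv ` D) \<subseteq> derangements r"
    using D(1) \<sigma> derangement_inv by auto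
  then have "card ({\<sigma>, inv \<sigma>} \<union> (D \<union> inv ` D)) \<le> card (derangements r)"
    using finite_derangements by (rule card_mono[rotated])
  ultimately show False using DD D(2) by linarith
qed

section \<open>Gram matrices and orbits\<close>

context lorentz
begin

lemma s_der_inv:
  assumes "\<sigma> \<in> derangements r"
  shows "s_der H r v (inv \<sigma>) = cnj (s_der H r v \<sigma>)"
proof -
  have \<sigma>: "\<sigma> permutes {..<r}" using assms by (simp add: derangements_def)
  have "s_der H r v (inv \<sigma>) = (\<Prod>i<r. h (v (\<sigma> i)) (v (inv \<sigma> (\<sigma> i))))"
    unfolding s_der_def using prod.permute[OF \<sigma>, of "\<lambda>i. h (v i) (v (inv \<sigma> i))"]
    by (simp add: comp_def)
  also have "\<dots> = (\<Prod>i<r. cnj (h (v i) (v (\<sigma> i))))"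
    unfolding permutes_inverses(2)[OF \<sigma>] by (intro prod.cong refl h_cnj)
  also have "\<dots> = cnj (s_der H r v \<sigma>)"
    by (simp add: s_der_def)
  finally show ?thesis .
qed

text \<open>Strictness of \<open>small\<close> leaves room for one prescribed value. Hence every
  nonzero Gram entry is a factor of a nonzero product, and the products detect which lines
  coincide.\<close>

lemma nonvanishing_derangement_through:
  assumes iso: "iso_tuple H r v" and small: "\<And>i. i < r \<Longrightarrow> 2 * card (line_class H r v i) < r"
    and ij: "i < r" "j < r" "h (v i) (v j) \<noteq> 0"
  obtains \<sigma> where "\<sigma> \<in> derangements r" "\<sigma> i = j" "s_der H r v \<sigma> \<noteq> 0"
proof -
  let ?cls = "line_class H r v"
  have cls: "?cls a = ?cls b \<longleftrightarrow> h (v a) (v b) = 0" if "a < r" "b < r" for a b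
    using line_class_eq[OF iso that] .
  have bound: "2 * card {a\<in>{..<r}. ?cls a = x} < r" for x
    using fibre_bound[OF iso, of "\<lambda>m. 2 * m < r"] small ij(1) by simp
  obtain f where f: "bij_betw f {..<r} {..<r}" "\<And>a. a \<in> {i} \<Longrightarrow> f a = (\<lambda>_. j) a"
    "\<And>a. a \<in> {..<r} \<Longrightarrow> ?cls (f a) \<noteq> ?cls a"
  proof (rule colour_avoiding_bij_extend[of "{..<r}" "{i}" "{j}" "\<lambda>_. j" ?cls])
    show "?cls j \<noteq> ?cls a" if "a \<in> {i}" for a
      using that cls[OF ij(1,2)] ij(3) by auto
    show "2 * card {a\<in>{..<r}. ?cls a = x} + card {i}
        \<le> card {..<r} + card {a\<in>{i}. ?cls a = x} + card {b\<in>{j}. ?cls b = x}" for x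
      using bound[of x] by simp
  qed (use ij in auto)
  have "f a \<noteq> a" if "a < r" for a
    using f(3)[of a] that by auto
  then obtain \<sigma> where \<sigma>: "\<sigma> \<in> derangements r" "\<And>a. a < r \<Longrightarrow> \<sigma> a = f a"
    using derangement_extend[OF f(1)] by blast
  have "h (v a) (v (f a)) \<noteq> 0" if "a < r" for a
  proof -
    have "f a < r" using f(1) that by (auto simp: bij_betw_def)
    then show ?thesis using f(3)[of a] cls[OF that] that by auto
  qed
  then have "s_der H r v \<sigma> \<noteq> 0" by (simp add: s_der_def \<sigma>(2))
  then show thesis using that \<sigma> f(2) ij(1) by simp
qed

text \<open>\<open>gram_pair\<close> wants one colouring for both tuples. That the same lines
  coincide in both is not given; it is recovered from the nonvanishing products through each nonzero
  entry.\<close>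

lemma gram_comparison:
  assumes iso: "iso_tuple H r v" "iso_tuple H r v'"
    and small: "\<And>i. i < r \<Longrightarrow> 2 * card (line_class H r v i) < r"
      "\<And>i. i < r \<Longrightarrow> 2 * card (line_class H r v' i) < r"
    and l: "l \<noteq> 0" and s: "\<And>\<sigma>. \<sigma> \<in> derangements r \<Longrightarrow> s_der H r v \<sigma> = l * s_der H r v' \<sigma>"
    and r: "0 < r"
  obtains t :: real and lam where "t \<noteq> 0" "\<And>i. i < r \<Longrightarrow> lam i \<noteq> 0"
    "\<And>i j. i < r \<Longrightarrow> j < r \<Longrightarrow> h (v i) (v j) = of_real t * lam i * cnj (lam j) * h (v' i) (v' j)"
proof -
  have imp: "h (w' i) (w' j) \<noteq> 0"
    if w: "iso_tuple H r w" "\<And>i. i < r \<Longrightarrow> 2 * card (line_class H r w i) < r"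
      "\<And>\<sigma>. \<sigma> \<in> derangements r \<Longrightarrow> s_der H r w \<sigma> \<noteq> 0 \<Longrightarrow> s_der H r w' \<sigma> \<noteq> 0"
      "i < r" "j < r" "h (w i) (w j) \<noteq> 0" for w w' i j
  proof -
    obtain \<sigma> where "\<sigma> \<in> derangements r" "\<sigma> i = j" "s_der H r w \<sigma> \<noteq> 0"
      using nonvanishing_derangement_through[OF w(1,2,4-6)] by blast
    then have "(\<Prod>a<r. h (w' a) (w' (\<sigma> a))) \<noteq> 0" "\<sigma> i = j"
      using w(3) by (auto simp: s_der_def)
    then show ?thesis using w(4) by auto
  qed
  have supp: "h (v i) (v j) = 0 \<longleftrightarrow> h (v' i) (v' j) = 0" if "i < r" "j < r" for i j
    using imp[of v v' i j] imp[of v' v i j] iso small s l that by (metis mult_eq_0_iff)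
  interpret gram_pair "{..<r}" "line_class H r v" "\<lambda>i j. h (v i) (v j)" "\<lambda>i j. h (v' i) (v' j)" l
  proof
    show "2 * card {a\<in>{..<r}. line_class H r v a = x} < card {..<r}" for x
      using fibre_bound[OF iso(1), of "\<lambda>m. 2 * m < r"] small(1) r by simp
    show z: "h (v i) (v j) = 0 \<longleftrightarrow> line_class H r v i = line_class H r v j"
      if "i \<in> {..<r}" "j \<in> {..<r}" for i j
      using line_class_eq[OF iso(1), of i j] that by simp
    show "h (v' i) (v' j) = 0 \<longleftrightarrow> line_class H r v i = line_class H r v j"
      if "i \<in> {..<r}" "j \<in> {..<r}" for i j
      using z[OF that] supp[of i j] that by simp
    show "(\<Prod>a\<in>{..<r}. h (v a) (v (f a))) = l * (\<Prod>a\<in>{..<r}. h (v' a) (v' (f a)))"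
      if f: "bij_betw f {..<r} {..<r}" for f
    proof (cases "\<exists>a<r. h (v a) (v (f a)) = 0")
      \<comment> \<open>A zero factor on one side is a zero factor on the other. This disposes of
        all bijections with a fixed point, about which \<open>s\<close> says nothing.\<close>
      case True
      then obtain a where a: "a < r" "h (v a) (v (f a)) = 0" by blast
      have "f a < r" using f a(1) by (auto simp: bij_betw_def)
      then have "h (v' a) (v' (f a)) = 0" using supp a by simp
      then have "(\<Prod>a\<in>{..<r}. h (v a) (v (f a))) = 0" "(\<Prod>a\<in>{..<r}. h (v' a) (v' (f a))) = 0"
        using a by (auto intro!: prod_zero)
      then show ?thesis by (simp only: mult_zero_right)
    next
      case False
      have "f a \<noteq> a" if "a < r" for a
        using False that iso(1) by (metis iso_tuple_def)
      then obtain \<sigma> where \<sigma>: "\<sigma> \<in> derangements r" "\<And>a. a < r \<Longrightarrow> \<sigma> a = f a"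
        using derangement_extend[OF f] by blast
      show ?thesis using s[OF \<sigma>(1)] by (simp add: s_der_def \<sigma>(2))
    qed
    show "h (v j) (v i) = cnj (h (v i) (v j))" "h (v' j) (v' i) = cnj (h (v' i) (v' j))" for i j
      by (rule h_cnj)+
  qed (use r l in auto)
  obtain t :: real and lam where "t \<noteq> 0" "\<And>i. i \<in> {..<r} \<Longrightarrow> lam i \<noteq> 0"
    "\<And>i j. i \<in> {..<r} \<Longrightarrow> j \<in> {..<r} \<Longrightarrow>
      h (v i) (v j) = of_real t * lam i * cnj (lam j) * h (v' i) (v' j)"
    using proportional_gram by blast
  then show thesis by (intro that[of t lam]) auto
qed

lemma same_orbit_of_gram:
  assumes iso: "iso_tuple H r v" "iso_tuple H r v'" and t: "t > 0"
    and lam: "\<And>i. i < r \<Longrightarrow> lam i \<noteq> 0"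
    and gram: "\<And>i j. i < r \<Longrightarrow> j < r \<Longrightarrow>
      h (v i) (v j) = of_real t * lam i * cnj (lam j) * h (v' i) (v' j)"
    and ab: "a < r" "b < r" "h (v a) (v b) \<noteq> 0"
  shows "same_orbit H r v v'"
proof -
  \<comment> \<open>The conjugate compensates for \<open>h\<close> being conjugate-linear in its
    first argument; the square root is where \<open>t > 0\<close> enters.\<close>
  define \<mu> where "\<mu> i = of_real (sqrt t) * cnj (lam i)" for i
  define u where "u i = \<mu> i *s v' i" for i
  have \<mu>0: "\<mu> i \<noteq> 0" if "i < r" for i using lam[OF that] t by (simp add: \<mu>_def)
  have u: "h (u i) (u j) = h (v i) (v j)" if "i < r" "j < r" for i j
  proof -
    have "of_real (sqrt t) * of_real (sqrt t) = (of_real t :: complex)"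
      using t by (simp flip: of_real_mult)
    moreover have "cnj (\<mu> i) * \<mu> j = of_real (sqrt t) * of_real (sqrt t) * lam i * cnj (lam j)"
      by (simp add: \<mu>_def mult_ac)
    ultimately have "cnj (\<mu> i) * \<mu> j = of_real t * lam i * cnj (lam j)" by simp
    moreover have "h (u i) (u j) = cnj (\<mu> i) * \<mu> j * h (v' i) (v' j)"
      by (simp add: u_def hform_simps)
    ultimately show ?thesis using gram[OF that] by (simp only:)
  qed
  have van: "h (v i) (v i) = 0" if "i < r" for i using iso(1) that by (simp add: iso_tuple_def)
  obtain g where g: "isometry H g" "\<And>i. i < r \<Longrightarrow> g *v v i = u i"
    using isometry_extension[of "v a" "v b" "u a" "u b" "{..<r}" u v] ab van u by auto
  obtain c where c: "cmod c = 1" "mat c ** g \<in> SU_h H"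
    using isometry_SU[OF g(1)] .
  have "same_lines r (\<lambda>i. (mat c ** g) *v v i) v'"
    unfolding same_lines_def
  proof (intro allI impI)
    fix i assume i: "i < r"
    have "(mat c ** g) *v v i = (c * \<mu> i) *s v' i"
      by (simp add: scalar_matrix_mult g(2)[OF i] u_def vector_smult_assoc)
    moreover have "c * \<mu> i \<noteq> 0" using c(1) \<mu>0[OF i] by auto
    ultimately show "\<exists>z. z \<noteq> 0 \<and> (mat c ** g) *v v i = z *s v' i" by blast
  qed
  then show ?thesis using c(2) by (auto simp: same_orbit_def)
qed

lemma nonorthogonal_pair:
  assumes "iso_tuple H r v" "\<sigma> \<in> derangements r" "s_der H r v \<sigma> \<noteq> 0" "0 < r"
  obtains a b where "a < r" "b < r" "h (v a) (v b) \<noteq> 0"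
proof -
  have "\<sigma> 0 < r"
    using assms(2,4) permutes_in_image[of \<sigma> "{..<r}" 0] by (simp add: derangements_def)
  moreover have "h (v 0) (v (\<sigma> 0)) \<noteq> 0"
    using assms(3,4) by (auto simp: s_der_def)
  ultimately show thesis using that assms(4) by blast
qed

text \<open>The sign of \<open>t\<close> is read off the triple product of three linearly independent lines, whose
  real part is negative; on two-dimensional spans it vanishes, and the sign is not determined.\<close>

lemma injective_dim3:
  assumes X: "Xss H r v" "Xss H r v'" and closed: "closed_orbit H r v" "closed_orbit H r v'"
    and dim: "vec.dim (v ` {..<r}) \<ge> 3" "vec.dim (v' ` {..<r}) \<ge> 3"
    and l: "l \<noteq> 0" and s: "\<And>\<sigma>. \<sigma> \<in> derangements r \<Longrightarrow> s_der H r v \<sigma> = l * s_der H r v' \<sigma>"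
    and r: "0 < r"
  shows "same_orbit H r v v'"
proof -
  have iso: "iso_tuple H r v" "iso_tuple H r v'" using X by (auto simp: Xss_def)
  obtain t lam where t: "t \<noteq> 0" and lam: "\<And>i. i < r \<Longrightarrow> lam i \<noteq> 0"
    and gram: "\<And>i j. i < r \<Longrightarrow> j < r \<Longrightarrow>
      h (v i) (v j) = of_real t * lam i * cnj (lam j) * h (v' i) (v' j)"
    using gram_comparison[OF iso closed_orbit_multiplicity[OF X(1) closed(1) dim(1)]
      closed_orbit_multiplicity[OF X(2) closed(2) dim(2)] l s r] by blast
  obtain \<sigma> where "\<sigma> \<in> derangements r" "s_der H r v \<sigma> \<noteq> 0"
    using Xss_nonvanishing[OF X(1)] .
  then obtain a b where ab: "a < r" "b < r" "h (v a) (v b) \<noteq> 0"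
    using nonorthogonal_pair[OF iso(1) _ _ r] by blast
  have "\<exists>c<r. v c \<notin> vec.span {v a, v b}"
  proof (rule ccontr)
    assume "\<not> ?thesis"
    then have "vec.dim (v ` {..<r}) \<le> card {v a, v b}"
      by (intro vec.dim_le_card) auto
    also have "\<dots> \<le> 2" by (simp add: card_insert_if)
    finally show False using dim(1) by simp
  qed
  then obtain c where c: "c < r" "v c \<notin> vec.span {v a, v b}" by blast
  have van: "h (v i) (v i) = 0" "h (v' i) (v' i) = 0" if "i < r" for i
    using iso that by (auto simp: iso_tuple_def)
  have neg: "Re (h (v a) (v b) * h (v b) (v c) * h (v c) (v a)) < 0"
    using van ab c by (intro Re_triple_product) auto
  define z where "z = h (v' a) (v' b) * h (v' b) (v' c) * h (v' c) (v' a)"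
  have "h (v' a) (v' b) \<noteq> 0" using gram[OF ab(1,2)] ab(3) by auto
  \<comment> \<open>The vector \<open>v' c\<close> might lie in the plane of \<open>v' a\<close> and
    \<open>v' b\<close>, so only the weak sign is available here; strictness comes from
    \<open>v\<close>.\<close>
  then have z: "Re z \<le> 0"
    unfolding z_def using van ab c by (intro Re_triple_product) auto
  define N where "N = (cmod (lam a))\<^sup>2 * (cmod (lam b))\<^sup>2 * (cmod (lam c))\<^sup>2"
  have "h (v a) (v b) * h (v b) (v c) * h (v c) (v a) =
      of_real t ^ 3 * ((lam a * cnj (lam a)) * (lam b * cnj (lam b)) * (lam c * cnj (lam c))) * z"
    unfolding gram[OF ab(1,2)] gram[OF ab(2) c(1)] gram[OF c(1) ab(1)] z_def
    by (simp add: power3_eq_cube mult_ac)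
  also have "\<dots> = of_real (t ^ 3 * N) * z"
    by (simp only: complex_norm_square[symmetric] N_def of_real_mult of_real_power)
  finally have "Re (h (v a) (v b) * h (v b) (v c) * h (v c) (v a)) = t ^ 3 * N * Re z"
    by (simp del: of_real_mult of_real_power)
  then have "(t ^ 3 * N) * Re z < 0" using neg by simp
  then have "t ^ 3 * N > 0" using z by (auto simp: mult_less_0_iff)
  moreover have "N \<ge> 0" by (simp add: N_def)
  ultimately have "t ^ 3 > 0" by (simp add: zero_less_mult_iff)
  then have "t > 0" by (simp add: zero_less_power_eq)
  then show ?thesis
    using same_orbit_of_gram[OF iso _ lam gram ab] by blast
qed

lemma injective_odd:
  assumes odd: "odd r" and D: "D \<subseteq> derangements r" "card D = card (derangements r) div 2"
    "\<And>\<sigma>. \<sigma> \<in> D \<Longrightarrow> inv \<sigma> \<notin> D"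
    and X: "Xss H r v" "Xss H r v'"
    and c: "c > 0" "\<And>\<sigma>. \<sigma> \<in> D \<Longrightarrow> s_der H r v \<sigma> = of_real c * s_der H r v' \<sigma>"
  shows "same_orbit H r v v'"
proof -
  have r: "0 < r" using odd by (cases r) auto
  have iso: "iso_tuple H r v" "iso_tuple H r v'" using X by (auto simp: Xss_def)
  have s: "s_der H r v \<sigma> = of_real c * s_der H r v' \<sigma>" if \<sigma>: "\<sigma> \<in> derangements r" for \<sigma>
  proof -
    have "\<sigma> \<in> D \<or> inv \<sigma> \<in> D"
      using derangement_half_cover[OF odd D(1,2) _ \<sigma>] D(3) by blast
    then show ?thesis
    proof
      assume "\<sigma> \<in> D"
      then show ?thesis by (rule c(2))
    next
      assume "inv \<sigma> \<in> D"
      \<comment> \<open>As \<open>c\<close> is real, conjugation carries the relation from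
        \<open>inv \<sigma>\<close> over to \<open>\<sigma>\<close>.\<close>
      then have "cnj (s_der H r v \<sigma>) = of_real c * cnj (s_der H r v' \<sigma>)"
        using c(2) s_der_inv[OF \<sigma>] by metis
      then show ?thesis
        by (metis complex_cnj_cnj complex_cnj_complex_of_real complex_cnj_mult)
    qed
  qed
  have small: "2 * card (line_class H r w i) < r" if "Xss H r w" "i < r" for w i
  proof -
    have "2 * card (line_class H r w i) \<le> r"
      using that by (intro semistable_multiplicity) (auto simp: Xss_def)
    moreover have "2 * card (line_class H r w i) \<noteq> r" using odd by (metis dvd_triv_left)
    ultimately show ?thesis by simp
  qed
  obtain t lam where t: "t \<noteq> 0" and lam: "\<And>i. i < r \<Longrightarrow> lam i \<noteq> 0"
    and gram: "\<And>i j. i < r \<Longrightarrow> j < r \<Longrightarrow>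
      h (v i) (v j) = of_real t * lam i * cnj (lam j) * h (v' i) (v' j)"
    using gram_comparison[OF iso small[OF X(1)] small[OF X(2)] _ s r] c(1) by auto
  obtain \<sigma> where \<sigma>: "\<sigma> \<in> derangements r" "s_der H r v \<sigma> \<noteq> 0"
    using Xss_nonvanishing[OF X(1)] .
  have perm: "\<sigma> permutes {..<r}" using \<sigma>(1) by (simp add: derangements_def)
  have \<sigma>r: "\<sigma> i < r" if "i < r" for i
    using permutes_in_image[OF perm, of i] that by simp
  \<comment> \<open>Since \<open>\<sigma>\<close> permutes the indices, every \<open>lam i\<close>
    meets its conjugate. This leads to \<open>c = t ^ r * N\<close>, and an odd power keeps the sign
    of \<open>t\<close>.\<close>
  define N where "N = (\<Prod>i<r. (cmod (lam i))\<^sup>2)"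
  have "s_der H r v \<sigma> = (\<Prod>i<r. of_real t * lam i * cnj (lam (\<sigma> i)) * h (v' i) (v' (\<sigma> i)))"
    unfolding s_der_def using gram \<sigma>r by (intro prod.cong) auto
  also have "\<dots> = of_real t ^ r * ((\<Prod>i<r. lam i) * (\<Prod>i<r. cnj (lam (\<sigma> i)))) * s_der H r v' \<sigma>"
    by (simp add: prod.distrib s_der_def mult_ac)
  also have "(\<Prod>i<r. cnj (lam (\<sigma> i))) = (\<Prod>i<r. cnj (lam i))"
    using prod.permute[OF perm, of "\<lambda>i. cnj (lam i)"] by (simp add: comp_def)
  also have "(\<Prod>i<r. lam i) * (\<Prod>i<r. cnj (lam i)) = of_real N"
    unfolding N_def of_real_prod complex_norm_square by (rule prod.distrib[symmetric])
  finally have "of_real c * s_der H r v' \<sigma> = of_real (t ^ r * N) * s_der H r v' \<sigma>"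
    using s[OF \<sigma>(1)] by simp
  moreover have "s_der H r v' \<sigma> \<noteq> 0" using \<sigma> s by auto
  ultimately have "c = t ^ r * N" by (simp only: mult_cancel_right of_real_eq_iff simp_thms)
  moreover have "N \<ge> 0" by (simp add: N_def prod_nonneg)
  ultimately have "t ^ r > 0" using c(1) by (simp add: zero_less_mult_iff)
  then have "t > 0" using odd r by (simp add: zero_less_power_eq)
  obtain a b where ab: "a < r" "b < r" "h (v a) (v b) \<noteq> 0"
    using nonorthogonal_pair[OF iso(1) \<sigma> r] .
  show ?thesis
    using same_orbit_of_gram[OF iso \<open>t > 0\<close> lam gram ab] .
qed

text \<open>For even \<open>r\<close> a fixed-point-free involution pairs each line with a different one, and turns
  \<open>s\<^sub>\<sigma>\<close> into a product of squared moduli.\<close>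

lemma nonvanishing_involution:
  assumes "even r" "Xss H r v"
  obtains \<sigma> f where "\<sigma> \<in> derangements r" "s_der H r v \<sigma> \<noteq> 0"
    "\<And>w. s_der H r w \<sigma> = of_real (\<Prod>i<r div 2. (cmod (h (w i) (w (f i))))\<^sup>2)"
proof -
  define m where "m = r div 2"
  have rm: "r = m + m" using assms(1) by (auto simp: m_def elim: evenE)
  have iso: "iso_tuple H r v" using assms(2) by (simp add: Xss_def)
  let ?cls = "line_class H r v"
  \<comment> \<open>The first half of the indices is paired with the second half: the counts of a
    colour in the two halves add up to its multiplicity, so Hall's condition becomes the bound
    \<open>r/2\<close>.\<close>
  obtain f where f: "bij_betw f {..<m} {m..<r}" "\<And>a. a \<in> {..<m} \<Longrightarrow> ?cls (f a) \<noteq> ?cls a"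
  proof (rule colour_avoiding_bij[of "{..<m}" "{m..<r}" ?cls])
    fix x
    have "card ({a\<in>{..<m}. ?cls a = x} \<union> {b\<in>{m..<r}. ?cls b = x}) =
        card {a\<in>{..<m}. ?cls a = x} + card {b\<in>{m..<r}. ?cls b = x}"
      by (rule card_Un_disjoint) auto
    moreover have "{a\<in>{..<m}. ?cls a = x} \<union> {b\<in>{m..<r}. ?cls b = x} = {a\<in>{..<r}. ?cls a = x}"
      using rm by auto
    ultimately show "card {a\<in>{..<m}. ?cls a = x} + card {b\<in>{m..<r}. ?cls b = x} \<le> card {..<m}"
      using Xss_multiplicity[OF assms(2), of x] rm by simp
  qed (use rm in auto)
  define f' where "f' = inv_into {..<m} f"
  have f': "bij_betw f' {m..<r} {..<m}"
    unfolding f'_def by (rule bij_betw_inv_into[OF f(1)])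
  have fm: "m \<le> f i" "f i < r" if "i < m" for i
    using bij_betwE[OF f(1)] that by auto
  have f'f: "f' (f i) = i" if "i < m" for i
    unfolding f'_def using bij_betw_inv_into_left[OF f(1)] that by auto
  define p where "p i = (if i < m then f i else f' i)" for i
  have "bij_betw p {..<m} {m..<r}"
    using f(1) by (subst bij_betw_cong[of _ _ f]) (auto simp: p_def)
  moreover have "bij_betw p {m..<r} {..<m}"
    using f' by (subst bij_betw_cong[of _ _ f']) (auto simp: p_def)
  ultimately have "bij_betw p ({..<m} \<union> {m..<r}) ({m..<r} \<union> {..<m})"
    by (rule bij_betw_combine) auto
  moreover have "{..<m} \<union> {m..<r} = {..<r}" using rm by auto
  ultimately have p: "bij_betw p {..<r} {..<r}" by (simp add: Un_commute)
  have "p i \<noteq> i" if "i < r" for i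
  proof (cases "i < m")
    case True
    then show ?thesis using fm(1)[of i] by (auto simp: p_def)
  next
    case False
    then have "f' i \<in> {..<m}" using that bij_betwE[OF f'] by (simp add: not_less)
    then show ?thesis using False by (auto simp: p_def)
  qed
  then obtain \<sigma> where \<sigma>: "\<sigma> \<in> derangements r" "\<And>i. i < r \<Longrightarrow> \<sigma> i = p i"
    using derangement_extend[OF p] by blast
  have s: "s_der H r w \<sigma> = of_real (\<Prod>i<m. (cmod (h (w i) (w (f i))))\<^sup>2)" for w
  proof -
    have "s_der H r w \<sigma> = (\<Prod>i\<in>{..<m} \<union> {m..<r}. h (w i) (w (p i)))"
      unfolding s_der_def \<open>{..<m} \<union> {m..<r} = {..<r}\<close> using \<sigma>(2) by (intro prod.cong) auto
    also have "\<dots> = (\<Prod>i<m. h (w i) (w (p i))) * (\<Prod>i\<in>{m..<r}. h (w i) (w (p i)))"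
      by (rule prod.union_disjoint) auto
    also have "(\<Prod>i\<in>{m..<r}. h (w i) (w (p i))) = (\<Prod>i<m. h (w (f i)) (w (p (f i))))"
      using prod.reindex_bij_betw[OF f(1), of "\<lambda>i. h (w i) (w (p i))"] by simp
    also have "\<dots> = (\<Prod>i<m. h (w (f i)) (w i))"
    proof (rule prod.cong)
      fix i assume "i \<in> {..<m}"
      then have "p (f i) = i" using fm(1)[of i] f'f[of i] by (simp add: p_def)
      then show "h (w (f i)) (w (p (f i))) = h (w (f i)) (w i)" by (simp only:)
    qed simp
    also have "(\<Prod>i<m. h (w i) (w (p i))) = (\<Prod>i<m. h (w i) (w (f i)))"
      by (intro prod.cong) (auto simp: p_def)
    also have "(\<Prod>i<m. h (w i) (w (f i))) * (\<Prod>i<m. h (w (f i)) (w i)) =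
        (\<Prod>i<m. h (w i) (w (f i)) * cnj (h (w i) (w (f i))))"
      by (simp only: prod.distrib[symmetric] h_cnj[symmetric])
    also have "\<dots> = of_real (\<Prod>i<m. (cmod (h (w i) (w (f i))))\<^sup>2)"
      by (simp only: complex_norm_square of_real_prod)
    finally show ?thesis .
  qed
  have "h (v i) (v (f i)) \<noteq> 0" if "i < m" for i
    using f(2)[of i] line_class_eq[OF iso, of i "f i"] fm(2)[OF that] that rm by auto
  then have "s_der H r v \<sigma> \<noteq> 0" unfolding s by simp
  then show thesis using that[OF \<sigma>(1)] s unfolding m_def by blast
qed

text \<open>The involution found for \<open>v\<close> gives a non-negative product for every tuple,
  \<open>v'\<close> included, so \<open>l\<close> is a quotient of two positive reals.\<close>

lemma positive_factor_even:
  assumes "even r" "Xss H r v"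
    and s: "\<And>\<sigma>. \<sigma> \<in> derangements r \<Longrightarrow> s_der H r v \<sigma> = l * s_der H r v' \<sigma>"
  obtains c :: real where "c > 0" "l = of_real c"
proof -
  obtain \<sigma> f where \<sigma>: "\<sigma> \<in> derangements r" "s_der H r v \<sigma> \<noteq> 0"
    and f: "\<And>w. s_der H r w \<sigma> = of_real (\<Prod>i<r div 2. (cmod (h (w i) (w (f i))))\<^sup>2)"
    using nonvanishing_involution[OF assms(1,2)] by metis
  define p where "p w = (\<Prod>i<r div 2. (cmod (h (w i) (w (f i))))\<^sup>2)" for w
  have nonneg: "p w \<ge> 0" for w by (simp add: p_def prod_nonneg)
  have p: "s_der H r w \<sigma> = of_real (p w)" for w
    using f unfolding p_def .
  have eq: "of_real (p v) = l * of_real (p v')" and "p v \<noteq> 0"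
    using s[OF \<sigma>(1)] \<sigma>(2) unfolding p by auto
  then have "p v' \<noteq> 0" by auto
  then have "l = of_real (p v / p v')" using eq by (simp add: field_simps)
  moreover have "p v / p v' > 0"
    using nonneg[of v] nonneg[of v'] \<open>p v \<noteq> 0\<close> \<open>p v' \<noteq> 0\<close> by (simp add: divide_pos_pos less_le)
  ultimately show thesis using that by blast
qed

end

theorem theorem4p16:
  fixes H :: "complex^'n^'n" and r :: nat
  assumes "CARD('n) \<ge> 3" and "r \<ge> 3"
    and "hermitian_mat H" and "signature_n1_1 H"
  shows
   "(\<forall>v v'. Xss H r v \<and> closed_orbit H r v \<and> vec.dim (v ` {..<r}) \<ge> 3 \<and>
           Xss H r v' \<and> closed_orbit H r v' \<and> vec.dim (v' ` {..<r}) \<ge> 3 \<longrightarrow>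
       (\<exists>\<sigma>\<in>derangements r. s_der H r v \<sigma> \<noteq> 0) \<and>
       ((\<exists>l::complex. l \<noteq> 0 \<and> (\<forall>\<sigma>\<in>derangements r. s_der H r v \<sigma> = l * s_der H r v' \<sigma>))
          \<longrightarrow> same_orbit H r v v'))
  \<and> (odd r \<longrightarrow> (\<forall>D. D \<subseteq> derangements r \<and> card D = card (derangements r) div 2 \<and>
                    (\<forall>\<sigma>\<in>D. inv \<sigma> \<notin> D) \<longrightarrow>
       (\<forall>v v'. Xss H r v \<and> closed_orbit H r v \<and> Xss H r v' \<and> closed_orbit H r v' \<longrightarrow>
          (\<exists>\<sigma>\<in>D. s_der H r v \<sigma> \<noteq> 0) \<and>
          ((\<exists>c::real. c > 0 \<and> (\<forall>\<sigma>\<in>D. s_der H r v \<sigma> = of_real c * s_der H r v' \<sigma>))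
             \<longrightarrow> same_orbit H r v v'))))
  \<and> (even r \<longrightarrow> (\<forall>v v'. Xss H r v \<and> Xss H r v' \<longrightarrow>
       ((\<exists>c::real. c > 0 \<and> (\<forall>\<sigma>\<in>derangements r. s_der H r v \<sigma> = of_real c * s_der H r v' \<sigma>))
        \<longleftrightarrow> (\<exists>l::complex. l \<noteq> 0 \<and> (\<forall>\<sigma>\<in>derangements r. s_der H r v \<sigma> = l * s_der H r v' \<sigma>)))))"
proof -
  interpret lorentz H using assms(3,4) by unfold_locales
  have r: "0 < r" using assms(2) by simp
  show ?thesis
  proof (intro conjI allI impI)
    fix v v' :: "nat \<Rightarrow> complex^'n"
    assume *: "Xss H r v \<and> closed_orbit H r v \<and> vec.dim (v ` {..<r}) \<ge> 3 \<and>
      Xss H r v' \<and> closed_orbit H r v' \<and> vec.dim (v' ` {..<r}) \<ge> 3"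
    show "\<exists>\<sigma>\<in>derangements r. s_der H r v \<sigma> \<noteq> 0"
      using Xss_nonvanishing * by blast
    assume "\<exists>l::complex. l \<noteq> 0 \<and> (\<forall>\<sigma>\<in>derangements r. s_der H r v \<sigma> = l * s_der H r v' \<sigma>)"
    then show "same_orbit H r v v'"
      using * injective_dim3[of r v v'] r by blast
  next
    fix D and v v' :: "nat \<Rightarrow> complex^'n"
    assume odd: "odd r"
    assume D: "D \<subseteq> derangements r \<and> card D = card (derangements r) div 2 \<and> (\<forall>\<sigma>\<in>D. inv \<sigma> \<notin> D)"
    assume *: "Xss H r v \<and> closed_orbit H r v \<and> Xss H r v' \<and> closed_orbit H r v'"
    obtain \<sigma> where \<sigma>: "\<sigma> \<in> derangements r" "s_der H r v \<sigma> \<noteq> 0"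
      using Xss_nonvanishing * by blast
    \<comment> \<open>Inverse derangements have conjugate products, so nonvanishing passes to
      whichever of the two lies in \<open>D\<close>.\<close>
    moreover have "s_der H r v (inv \<sigma>) \<noteq> 0" using \<sigma> by (simp add: s_der_inv)
    moreover have "\<sigma> \<in> D \<or> inv \<sigma> \<in> D"
      using derangement_half_cover[OF odd _ _ _ \<sigma>(1), of D] D by blast
    ultimately show "\<exists>\<sigma>\<in>D. s_der H r v \<sigma> \<noteq> 0" by blast
    assume "\<exists>c::real. c > 0 \<and> (\<forall>\<sigma>\<in>D. s_der H r v \<sigma> = of_real c * s_der H r v' \<sigma>)"
    then show "same_orbit H r v v'"
      using injective_odd[OF odd, of D v v'] D * by blast
  next
    fix v v' :: "nat \<Rightarrow> complex^'n"
    assume even: "even r" and *: "Xss H r v \<and> Xss H r v'"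
    show "(\<exists>c::real. c > 0 \<and> (\<forall>\<sigma>\<in>derangements r. s_der H r v \<sigma> = of_real c * s_der H r v' \<sigma>))
        \<longleftrightarrow> (\<exists>l::complex. l \<noteq> 0 \<and> (\<forall>\<sigma>\<in>derangements r. s_der H r v \<sigma> = l * s_der H r v' \<sigma>))"
      (is "?L \<longleftrightarrow> ?R")
    proof
      assume ?L
      then obtain c :: real where "c > 0"
        "\<forall>\<sigma>\<in>derangements r. s_der H r v \<sigma> = of_real c * s_der H r v' \<sigma>" by blast
      then show ?R by (intro exI[of _ "of_real c"]) auto
    next
      assume ?R
      then obtain l where l: "\<forall>\<sigma>\<in>derangements r. s_der H r v \<sigma> = l * s_der H r v' \<sigma>" by blast
      obtain c :: real where "c > 0" "l = of_real c"
        using positive_factor_even[OF even, of v l v'] l * by blast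
      then show ?L using l by blast
    qed
  qed
qed

end
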